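(* Let $\omega=(\omega_n)_{n\in\mathbb{N}}$ be a frequency and let $J\subset\mathbb{N}$ be a finite subset. Then $$\boldsymbol{\lambda}\big(\mathcal{H}_\infty^{J}(\omega)\big)=\lim_{T\to\infty}\frac{1}{2T}\int_{-T}^{T}\Big|\sum_{n\in J}e^{-i\omega_n t}\Big|\,dt .$$
   Context: A frequency is a strictly increasing, non-negative real sequence $\omega=(\omega_n)_{n\in\mathbb{N}}$ with $\omega_n\to\infty$. For a finite set $J\subset\mathbb{N}$, $\mathcal{H}_\infty^J(\omega)$ is the finite dimensional complex Banach space of all $\omega$-Dirichlet polynomials $D(s)=\sum_{n\in J}a_n e^{-\omega_n s}$, $s\in\mathbb{C}$, with $a_n\in\mathbb{C}$, endowed with the norm $\|D\|_\infty=\sup_{t\in\mathbb{R}}\big|\sum_{n\in J}a_n e^{-i\omega_n t}\big|$ $(=\sup_{\operatorname{Re}s>0}|D(s)|)$. For a closed subspace $X$ of a complex Banach space $Y$, the relative projection constant is $\boldsymbol{\lambda}(X,Y)=\inf\{\|P\|: P\colon Y\to X \text{ bounded linear},\ P|_X=\mathrm{id}_X\}$ (with $\inf\emptyset=\infty$). The (absolute) projection constant of a finite dimensional Banach space $X$ is $\boldsymbol{\lambda}(X)=\sup\boldsymbol{\lambda}(I(X),Y)$, the supremum being over all Banach spaces $Y$ and isometric linear embeddings $I\colon X\to Y$ with $I(X)$ complemented in $Y$. *)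

theory Defs
  imports
    "HOL-Analysis.Analysis"
    "HOL-Algebra.Module"
begin

(* Banach spaces are carrier-based: the projection constant is a supremum over all Banach
   spaces Y, which cannot range over types.  The fields mult and one that the library's module
   record inherits from the ring record play no role. *)
record 'b cnormed = "(complex, 'b) module" +
  nrm :: "'b \<Rightarrow> real"

definition complex_field :: "complex ring" where
  "complex_field = \<lparr>carrier = UNIV, mult = (*), one = 1, zero = 0, add = (+)\<rparr>"

locale complex_banach = module complex_field Y for Y :: "'b cnormed" (structure) +
  assumes nrm_nonneg: "x \<in> carrier Y \<Longrightarrow> 0 \<le> nrm Y x"
    and nrm_eq_zero_iff: "x \<in> carrier Y \<Longrightarrow> nrm Y x = 0 \<longleftrightarrow> x = \<zero>"
    and nrm_triangle:
      "x \<in> carrier Y \<Longrightarrow> y \<in> carrier Y \<Longrightarrow> nrm Y (x \<oplus> y) \<le> nrm Y x + nrm Y y"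
    and nrm_smult: "x \<in> carrier Y \<Longrightarrow> nrm Y (c \<odot> x) = cmod c * nrm Y x"
    and complete:
      "range u \<subseteq> carrier Y \<Longrightarrow>
       (\<forall>\<epsilon>>0. \<exists>N. \<forall>m\<ge>N. \<forall>n\<ge>N. nrm Y (u m \<ominus> u n) < \<epsilon>) \<Longrightarrow>
       \<exists>l\<in>carrier Y. (\<lambda>n. nrm Y (u n \<ominus> l)) \<longlonglongrightarrow> 0"

definition linear_between :: "'a cnormed \<Rightarrow> 'b cnormed \<Rightarrow> ('a \<Rightarrow> 'b) \<Rightarrow> bool" where
  "linear_between X Y f \<longleftrightarrow>
     f \<in> carrier X \<rightarrow> carrier Y \<and>
     (\<forall>x\<in>carrier X. \<forall>y\<in>carrier X. f (x \<oplus>\<^bsub>X\<^esub> y) = f x \<oplus>\<^bsub>Y\<^esub> f y) \<and>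
     (\<forall>c. \<forall>x\<in>carrier X. f (c \<odot>\<^bsub>X\<^esub> x) = c \<odot>\<^bsub>Y\<^esub> f x)"

definition isometric_embedding :: "'a cnormed \<Rightarrow> 'b cnormed \<Rightarrow> ('a \<Rightarrow> 'b) \<Rightarrow> bool" where
  "isometric_embedding X Y f \<longleftrightarrow>
     linear_between X Y f \<and> (\<forall>x\<in>carrier X. nrm Y (f x) = nrm X x)"

definition op_norm :: "'a cnormed \<Rightarrow> 'b cnormed \<Rightarrow> ('a \<Rightarrow> 'b) \<Rightarrow> ennreal" where
  "op_norm X Y f = (SUP x\<in>{x \<in> carrier X. nrm X x \<le> 1}. ennreal (nrm Y (f x)))"

definition projections :: "'b set \<Rightarrow> 'b cnormed \<Rightarrow> ('b \<Rightarrow> 'b) set" where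
  "projections S Y =
     {P. linear_between Y (Y\<lparr>carrier := S\<rparr>) P \<and> op_norm Y Y P < \<infinity> \<and> (\<forall>x\<in>S. P x = x)}"

(* Inf {} is \<infinity> in ennreal. *)
definition relative_projection_constant :: "'b set \<Rightarrow> 'b cnormed \<Rightarrow> ennreal" where
  "relative_projection_constant S Y = (INF P\<in>projections S Y. op_norm Y Y P)"

(* The Banach spaces Y in the supremum have their carrier in the type
   'u + ('a \<Rightarrow> complex), where 'u is an arbitrary type.  A Banach space of any type is isomorphic
   to one of these, for a suitable 'u.  The second summand makes the value independent of 'u for
   finite dimensional X: choosing a norming functional for each point embeds X isometrically into
   l_infinity(carrier X), whose elements are functions 'a \<Rightarrow> complex, and this space is
   1-injective, so it attains the supremum. *)
definition projection_constant :: "'u itself \<Rightarrow> 'a cnormed \<Rightarrow> ennreal" where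
  "projection_constant (_ :: 'u itself) X =
     Sup {relative_projection_constant (I ` carrier X) Y |
            (Y :: ('u + ('a \<Rightarrow> complex)) cnormed) I.
            complex_banach Y \<and> isometric_embedding X Y I \<and>
            projections (I ` carrier X) Y \<noteq> {}}"

definition frequency :: "(nat \<Rightarrow> real) \<Rightarrow> bool" where
  "frequency \<omega> \<longleftrightarrow> strict_mono \<omega> \<and> (\<forall>n. 0 \<le> \<omega> n) \<and> filterlim \<omega> at_top sequentially"

definition dirichlet_polynomial ::
    "(nat \<Rightarrow> real) \<Rightarrow> nat set \<Rightarrow> (nat \<Rightarrow> complex) \<Rightarrow> complex \<Rightarrow> complex" where
  "dirichlet_polynomial \<omega> J a s = (\<Sum>n\<in>J. a n * exp (- of_real (\<omega> n) * s))"

(* The norm is the supremum over the imaginary axis, s = i t. *)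
definition dirichlet_space :: "(nat \<Rightarrow> real) \<Rightarrow> nat set \<Rightarrow> (complex \<Rightarrow> complex) cnormed" where
  "dirichlet_space \<omega> J =
     \<lparr>carrier = range (dirichlet_polynomial \<omega> J),
      mult = undefined,
      one = undefined,
      zero = (\<lambda>s. 0),
      add = (\<lambda>D E s. D s + E s),
      smult = (\<lambda>c D s. c * D s),
      nrm = (\<lambda>D. SUP t::real. cmod (D (\<i> * of_real t)))\<rparr>"

end

theory Submission
  imports Defs
begin

text \<open>
  Let \<open>D(t) = \<Sum>\<^bsub>n\<in>J\<^esub> e\<^bsup>-\<i>\<omega>\<^sub>nt\<^esup>\<close> be the Dirichlet kernel of \<open>J\<close>.  Convolution of almost
  periodic functions with \<open>D\<close>, taken with respect to the mean \<open>M(f) = lim (1/2T) \<integral> f\<close>, reproduces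
  Dirichlet polynomials, and its norm for the supremum norm is the mean \<open>L\<close> of \<open>|D|\<close>.  The theorem
  says that this projection is optimal and that no superspace requires a worse one.

  The limit exists because \<open>|D|\<close> is almost periodic: \<open>|D|\<^sup>2\<close> is a trigonometric polynomial, the square
  root is a uniform limit of polynomials, and trigonometric polynomials form an algebra with obvious
  means (\<open>polynomial_sign_approximation\<close>, \<open>dirichlet_kernel_mean\<close>).

  Upper estimate (\<open>relative_projection_constant_le\<close>).  In an arbitrary superspace \<open>Y\<close> the evaluations
  at the points \<open>\<i>t\<close> extend without increase of norm by the Hahn-Banach theorem, which allows convolution
  with \<open>D\<close> to be imitated on \<open>Y\<close>.  The extensions depend on \<open>t\<close> in an uncontrolled way, so the mean
  is replaced by averages over finitely many equidistant samples.  These agree with the mean up to a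
  small error, uniformly under translation (\<open>ap_mean_discrete\<close>), and a small correction turns the
  sampled convolution into a projection of norm at most \<open>L + \<epsilon>\<close>.

  Lower estimate (\<open>projection_norm_ge\<close>).  The space of all bounded functions on the line is a superspace
  for which every projection has norm at least \<open>L\<close>: averaging a projection over translations produces
  convolution with \<open>D\<close>, and testing on an approximate sign of \<open>D\<close> shows its norm
  (\<open>averaging_lower_bound\<close>).  The averages are only formed after evaluation on trigonometric
  polynomials, where they are means of scalar trigonometric polynomials.
\<close>

section \<open>Mean values of trigonometric polynomials\<close>

text \<open>
  The second argument is the mean value, that is, the coefficient at frequency 0.  Having it in the
  relation means that every statement which is linear in the polynomial and its mean follows by
  induction from the monomials.
\<close>

inductive trig_poly :: "(real \<Rightarrow> complex) \<Rightarrow> complex \<Rightarrow> bool" where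
  monomial: "trig_poly (\<lambda>t. c * cis (\<nu> * t)) (if \<nu> = 0 then c else 0)"
| add: "trig_poly f m \<Longrightarrow> trig_poly g k \<Longrightarrow> trig_poly (\<lambda>t. f t + g t) (m + k)"

lemma trig_poly_const: "trig_poly (\<lambda>t. c) c"
  using trig_poly.monomial[of c 0] by simp

lemma trig_poly_sum:
  assumes "finite A" "\<And>i. i \<in> A \<Longrightarrow> trig_poly (f i) (m i)"
  shows "trig_poly (\<lambda>t. \<Sum>i\<in>A. f i t) (\<Sum>i\<in>A. m i)"
  using assms by (induction A rule: finite_induct) (auto intro: trig_poly_const trig_poly.add)

lemma trig_poly_cmult:
  assumes "trig_poly f m"
  shows "trig_poly (\<lambda>t. c * f t) (c * m)"
  using assms
proof induction
  case (monomial d \<nu>)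
  then show ?case using trig_poly.monomial[of "c * d" \<nu>] by (cases "\<nu> = 0") (simp_all add: mult.assoc)
next
  case (add f m g k)
  then show ?case using trig_poly.add by (fastforce simp: distrib_left)
qed

lemma trig_poly_diff:
  assumes "trig_poly f m" "trig_poly g k"
  shows "trig_poly (\<lambda>t. f t - g t) (m - k)"
  using trig_poly.add[OF assms(1) trig_poly_cmult[OF assms(2), of "-1"]] by simp

lemma trig_poly_mult:
  assumes "trig_poly f m" "trig_poly g k"
  shows "\<exists>l. trig_poly (\<lambda>t. f t * g t) l"
  using assms
proof (induction arbitrary: g k)
  case (monomial c \<nu>)
  from monomial.prems show ?case
  proof induction
    case (monomial d \<mu>)
    have "c * cis (\<nu> * t) * (d * cis (\<mu> * t)) = c * d * cis ((\<nu> + \<mu>) * t)" for t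
      by (simp add: distrib_right cis_mult[symmetric])
    then show ?case using trig_poly.monomial[of "c * d" "\<nu> + \<mu>"] by (simp only:) blast
  next
    case (add f m g k)
    then show ?case by (auto simp: distrib_left dest: trig_poly.add)
  qed
next
  case (add f m g k)
  from add.IH(1)[OF add.prems] add.IH(2)[OF add.prems] show ?case
    by (auto simp: distrib_right dest: trig_poly.add)
qed

lemma trig_poly_continuous:
  assumes "trig_poly f m"
  shows "continuous_on S f"
  using assms by induction (auto intro!: continuous_intros)

text \<open>
  A nonzero frequency \<open>\<nu>\<close> sampled with a step \<open>0 < h < 2\<pi>/|\<nu>|\<close> gives a geometric progression
  with ratio different from 1, whose partial sums are bounded; shifting by \<open>s\<close> only multiplies them
  by a number of modulus 1, so the convergence is uniform in \<open>s\<close>.  Samples, unlike integrals, can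
  later be applied to families of functionals that depend on \<open>t\<close> in no regular way.
\<close>

lemma trig_poly_discrete_mean:
  assumes "trig_poly f m"
  shows "\<forall>\<^sub>F h in at_right 0. uniform_limit UNIV
           (\<lambda>N s. (\<Sum>j<N. f (s - real j * h)) / of_nat N) (\<lambda>_. m) sequentially"
  using assms
proof induction
  case (monomial c \<nu>)
  show ?case
  proof (cases "\<nu> = 0")
    case True
    have "uniform_limit UNIV (\<lambda>N s. (\<Sum>j<N. c * cis (\<nu> * (s - real j * h))) / of_nat N)
            (\<lambda>_::real. c) sequentially" for h
    proof (rule uniform_limitI)
      fix e :: real assume "e > 0"
      show "\<forall>\<^sub>F N in sequentially. \<forall>s\<in>UNIV. dist ((\<Sum>j<N. c * cis (\<nu> * (s - real j * h))) / of_nat N) c < e"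
        using eventually_gt_at_top[of 0] by eventually_elim (use True \<open>e > 0\<close> in simp)
    qed
    then show ?thesis using True by simp
  next
    case False
    have "\<forall>\<^sub>F h in at_right 0. 0 < h \<and> h < 2 * pi / \<bar>\<nu>\<bar>"
      using False by (auto simp: eventually_at_right_field intro!: exI[of _ "2 * pi / \<bar>\<nu>\<bar>"])
    then show ?thesis
    proof (rule eventually_mono)
      fix h :: real assume h: "0 < h \<and> h < 2 * pi / \<bar>\<nu>\<bar>"
      define z where "z = cis (- \<nu> * h)"
      have "z \<noteq> 1"
      proof
        assume "z = 1"
        then have "cos (\<nu> * h) = 1" unfolding z_def by (auto simp: complex_eq_iff)
        then obtain n :: int where n: "\<nu> * h = of_int n * 2 * pi"
          using cos_one_2pi_int by auto
        have a: "\<bar>\<nu> * h\<bar> < 2 * pi" "\<bar>\<nu> * h\<bar> > 0" using h False by (auto simp: field_simps abs_mult)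
        then have "\<bar>real_of_int n\<bar> < 1" unfolding n by (simp add: abs_mult)
        then have "n = 0" by linarith
        with n a show False by simp
      qed
      have eq: "(\<Sum>j<N. c * cis (\<nu> * (s - real j * h))) / of_nat N
              = c * cis (\<nu> * s) * ((1 - z ^ N) / (1 - z)) / of_nat N" for N s
      proof -
        have "c * cis (\<nu> * (s - real j * h)) = c * cis (\<nu> * s) * z ^ j" for j
        proof -
          have "cis (\<nu> * (s - real j * h)) = cis (\<nu> * s) * cis (real j * (- \<nu> * h))"
            unfolding cis_mult by (rule arg_cong[where f = cis]) (simp add: algebra_simps)
          then show ?thesis unfolding z_def Complex.DeMoivre by (simp only: mult.assoc)
        qed
        then show ?thesis using \<open>z \<noteq> 1\<close>
          by (simp only: sum_distrib_left[symmetric] sum_gp_strict if_False)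
      qed
      define C where "C = cmod c * (2 / cmod (1 - z))"
      have bound: "cmod ((\<Sum>j<N. c * cis (\<nu> * (s - real j * h))) / of_nat N) \<le> C / real N" for N s
      proof -
        have "cmod (1 - z ^ N) \<le> 2"
          using norm_triangle_ineq4[of 1 "z ^ N"] by (simp add: z_def norm_power)
        then have "cmod c * (cmod (1 - z ^ N) / cmod (1 - z)) / real N \<le> C / real N"
          unfolding C_def by (intro divide_right_mono mult_left_mono) auto
        then show ?thesis unfolding eq by (simp only: norm_mult norm_divide norm_cis norm_of_nat mult_1_right)
      qed
      have lim: "(\<lambda>N. C / real N) \<longlonglongrightarrow> 0" by (rule lim_const_over_n)
      have "uniform_limit UNIV (\<lambda>N s. (\<Sum>j<N. c * cis (\<nu> * (s - real j * h))) / of_nat N)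
                   (\<lambda>_::real. 0) sequentially"
      proof (intro uniform_limitI)
        fix e :: real assume "e > 0"
        with lim have "\<forall>\<^sub>F N in sequentially. C / real N < e" by (rule order_tendstoD)
        then show "\<forall>\<^sub>F N in sequentially. \<forall>s\<in>UNIV.
            dist ((\<Sum>j<N. c * cis (\<nu> * (s - real j * h))) / of_nat N) 0 < e"
          by eventually_elim (use bound in \<open>auto simp only: dist_norm diff_zero intro: le_less_trans\<close>)
      qed
      then show "uniform_limit UNIV (\<lambda>N s. (\<Sum>j<N. c * cis (\<nu> * (s - real j * h))) / of_nat N)
                   (\<lambda>_::real. if \<nu> = 0 then c else 0) sequentially"
        using False by simp
    qed
  qed
next
  case (add f m g k)
  from add.IH show ?case
    by eventually_elim (simp add: sum.distrib add_divide_distrib uniform_limit_add)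
qed

lemma trig_poly_mean_le:
  assumes "trig_poly f m" "\<And>t. cmod (f t) \<le> B"
  shows "cmod m \<le> B"
proof -
  obtain h where "uniform_limit UNIV
           (\<lambda>N s. (\<Sum>j<N. f (s - real j * h)) / of_nat N) (\<lambda>_. m) sequentially"
    using eventually_happens[OF trig_poly_discrete_mean[OF assms(1)]] by auto
  then have lim: "(\<lambda>N. (\<Sum>j<N. f (0 - real j * h)) / of_nat N) \<longlonglongrightarrow> m"
    by (rule tendsto_uniform_limitI) simp
  have "cmod ((\<Sum>j<N. f (0 - real j * h)) / of_nat N) \<le> B" if "N > 0" for N
  proof -
    have "cmod (\<Sum>j<N. f (0 - real j * h)) \<le> real (card {..<N}) * B"
      by (rule sum_norm_bound) (use assms in auto)
    then show ?thesis using that by (simp add: norm_divide field_simps)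
  qed
  then show ?thesis
    by (intro tendsto_upperbound[OF tendsto_norm[OF lim]])
      (auto intro!: eventually_mono[OF eventually_gt_at_top[of 0]])
qed

text \<open>
  The same fact for continuous averages: the antiderivative of a nonconstant monomial is bounded.
\<close>

lemma trig_poly_integral_mean:
  assumes "trig_poly f m"
  shows "((\<lambda>T. integral {-T..T} f / of_real (2 * T)) \<longlongrightarrow> m) at_top"
  using assms
proof induction
  case (monomial c \<nu>)
  show ?case
  proof (cases "\<nu> = 0")
    case True
    have "\<forall>\<^sub>F T::real in at_top. c = integral {-T..T} (\<lambda>t. c * cis (\<nu> * t)) / of_real (2 * T)"
      using eventually_gt_at_top[of 0] by eventually_elim (use True in \<open>simp add: scaleR_conv_of_real\<close>)
    then show ?thesis
      using True by (auto intro: Lim_transform_eventually[OF tendsto_const])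
  next
    case False
    have int: "integral {-T..T} (\<lambda>t. c * cis (\<nu> * t)) = c * (cis (\<nu> * T) - cis (- \<nu> * T)) / (\<i> * \<nu>)"
      if "T > 0" for T
    proof -
      have "((\<lambda>t. c * cis (\<nu> * t)) has_integral
              c / (\<i> * \<nu>) * cis (\<nu> * T) - c / (\<i> * \<nu>) * cis (\<nu> * (-T))) {-T..T}"
      proof (rule fundamental_theorem_of_calculus)
        show "-T \<le> T" using that by simp
        fix x assume "x \<in> {-T..T}"
        have "((\<lambda>t. cis (\<nu> * t)) has_vector_derivative \<nu> *\<^sub>R (\<i> * cis (\<nu> * x))) (at x within {-T..T})"
          unfolding has_vector_derivative_def
          by (rule has_derivative_eq_rhs, rule has_derivative_cis, rule has_derivative_mult_right,
              rule has_derivative_ident) (simp add: fun_eq_iff mult.commute)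
        from has_vector_derivative_mult_right[OF this, of "c / (\<i> * \<nu>)"]
        have "((\<lambda>t. c / (\<i> * \<nu>) * cis (\<nu> * t)) has_vector_derivative
                c / (\<i> * \<nu>) * \<nu> *\<^sub>R (\<i> * cis (\<nu> * x))) (at x within {-T..T})" .
        moreover have "c / (\<i> * \<nu>) * \<nu> *\<^sub>R (\<i> * cis (\<nu> * x)) = c * cis (\<nu> * x)"
          using False by (simp add: scaleR_conv_of_real divide_simps mult.left_commute[of \<i> c])
        ultimately show "((\<lambda>t. c / (\<i> * \<nu>) * cis (\<nu> * t)) has_vector_derivative c * cis (\<nu> * x)) (at x within {-T..T})"
          by (simp only:)
      qed
      then show ?thesis
        by (simp only: integral_unique) (simp add: diff_divide_distrib right_diff_distrib)
    qed
    define C where "C = cmod c * 2 / \<bar>\<nu>\<bar>"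
    have "\<forall>\<^sub>F T::real in at_top. cmod (integral {-T..T} (\<lambda>t. c * cis (\<nu> * t)) / of_real (2 * T)) \<le> C / (2 * T)"
      using eventually_gt_at_top[of 0]
    proof eventually_elim
      case (elim T)
      have "cmod (cis (\<nu> * T) - cis (- \<nu> * T)) \<le> 2"
        using norm_triangle_ineq4[of "cis (\<nu> * T)" "cis (- \<nu> * T)"] by simp
      then have "cmod c * cmod (cis (\<nu> * T) - cis (- \<nu> * T)) / \<bar>\<nu>\<bar> / (2 * T) \<le> C / (2 * T)"
        unfolding C_def using elim by (intro divide_right_mono mult_left_mono) auto
      then show ?case unfolding int[OF elim] using elim by (simp add: norm_mult norm_divide)
    qed
    moreover have "((\<lambda>T. C / (2 * T)) \<longlongrightarrow> 0) at_top"
      by (intro tendsto_divide_0[OF tendsto_const] filterlim_at_top_imp_at_infinity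
          filterlim_tendsto_pos_mult_at_top[OF tendsto_const _ filterlim_ident]) simp
    ultimately show ?thesis using False by (auto intro: Lim_null_comparison)
  qed
next
  case (add f m g k)
  have "integral {-T..T} (\<lambda>t. f t + g t) = integral {-T..T} f + integral {-T..T} g" for T
    using add.hyps by (intro integral_add integrable_continuous_interval trig_poly_continuous)
  with tendsto_add[OF add.IH] show ?case by (simp add: add_divide_distrib)
qed

section \<open>Almost periodic functions\<close>

text \<open>
  Uniform limits of trigonometric polynomials are the functions that are almost periodic in the sense
  of Bohr, and \<open>L\<close> is the Bohr mean of \<open>f\<close>.
\<close>

definition ap_mean :: "(real \<Rightarrow> complex) \<Rightarrow> complex \<Rightarrow> bool" where
  "ap_mean f L \<longleftrightarrow>
     (\<forall>\<epsilon>>0. \<exists>g m. trig_poly g m \<and> (\<forall>t. cmod (f t - g t) \<le> \<epsilon>) \<and> cmod (m - L) \<le> \<epsilon>)"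

lemma trig_poly_imp_ap_mean: "trig_poly f m \<Longrightarrow> ap_mean f m"
  unfolding ap_mean_def by fastforce

lemma trig_poly_mean_close:
  assumes "trig_poly f m" "ap_mean g L" "\<And>t. cmod (f t - g t) \<le> B"
  shows "cmod (m - L) \<le> B"
proof (rule field_le_epsilon)
  fix e :: real assume "0 < e"
  then obtain p k where pk: "trig_poly p k" "\<And>t. cmod (g t - p t) \<le> e / 2" "cmod (k - L) \<le> e / 2"
    using assms(2) unfolding ap_mean_def by (metis half_gt_zero)
  have "cmod (f t - p t) \<le> B + e / 2" for t
    using norm_triangle_le[of "f t - g t" "g t - p t" "B + e / 2"] assms(3)[of t] pk(2)[of t] by simp
  then have "cmod (m - k) \<le> B + e / 2"
    by (rule trig_poly_mean_le[OF trig_poly_diff[OF assms(1) pk(1)]])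
  then show "cmod (m - L) \<le> B + e"
    using norm_triangle_le[of "m - k" "k - L" "B + e"] pk(3) by simp
qed

text \<open>
  The mean is a contraction for the supremum norm, so the means of uniformly convergent
  trigonometric polynomials form a Cauchy sequence.
\<close>

lemma ap_mean_exists:
  assumes "\<And>\<epsilon>. \<epsilon> > 0 \<Longrightarrow> \<exists>g m. trig_poly g m \<and> (\<forall>t. cmod (f t - g t) \<le> \<epsilon>)"
  shows "\<exists>L. ap_mean f L"
proof -
  have "\<forall>n::nat. \<exists>g m. trig_poly g m \<and> (\<forall>t. cmod (f t - g t) \<le> 1 / Suc n)"
    using assms by simp
  then obtain g m where gm: "\<And>n::nat. trig_poly (g n) (m n)"
      "\<And>n t. cmod (f t - g n t) \<le> 1 / Suc n"
    by metis
  have dist: "cmod (m i - m j) \<le> 1 / Suc i + 1 / Suc j" for i j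
  proof (rule trig_poly_mean_le[OF trig_poly_diff[OF gm(1) gm(1)]])
    fix t show "cmod (g i t - g j t) \<le> 1 / Suc i + 1 / Suc j"
      using norm_triangle_le[of "g i t - f t" "f t - g j t"] gm(2)[of t i] gm(2)[of t j]
      by (simp add: norm_minus_commute)
  qed
  have "Cauchy m"
  proof (rule metric_CauchyI)
    fix e :: real assume "e > 0"
    then obtain M where M: "1 / Suc M < e / 2"
      using reals_Archimedean[of "e / 2"] by (auto simp: inverse_eq_divide)
    show "\<exists>M. \<forall>i\<ge>M. \<forall>j\<ge>M. dist (m i) (m j) < e"
    proof (intro exI allI impI)
      fix i j assume "M \<le> i" "M \<le> j"
      then have "1 / real (Suc i) \<le> 1 / Suc M" "1 / real (Suc j) \<le> 1 / Suc M"
        by (auto simp: field_simps)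
      then show "dist (m i) (m j) < e" using dist[of i j] M by (simp add: dist_norm)
    qed
  qed
  then obtain L where L: "m \<longlonglongrightarrow> L" using Cauchy_convergent convergent_def by blast
  have "ap_mean f L" unfolding ap_mean_def
  proof (intro allI impI)
    fix e :: real assume "e > 0"
    have "(\<lambda>n. 1 / real (Suc n)) \<longlonglongrightarrow> 0" by (rule LIMSEQ_Suc[OF lim_const_over_n])
    then have "\<forall>\<^sub>F n in sequentially. 1 / real (Suc n) < e" using \<open>e > 0\<close> by (rule order_tendstoD)
    moreover have "\<forall>\<^sub>F n in sequentially. dist (m n) L < e" using L \<open>e > 0\<close> by (rule tendstoD)
    ultimately obtain n where n: "1 / real (Suc n) < e" "dist (m n) L < e"
      by (metis (mono_tags, lifting) eventually_conj eventually_happens sequentially_bot)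
    then show "\<exists>g k. trig_poly g k \<and> (\<forall>t. cmod (f t - g t) \<le> e) \<and> cmod (k - L) \<le> e"
    proof (intro exI conjI allI)
      show "trig_poly (g n) (m n)" by (rule gm(1))
      show "cmod (f t - g n t) \<le> e" for t using gm(2)[of t n] n(1) by linarith
      show "cmod (m n - L) \<le> e" using n(2) by (simp add: dist_norm)
    qed
  qed
  then show ?thesis ..
qed

lemma ap_mean_discrete:
  assumes "ap_mean f L" "\<epsilon> > 0"
  shows "\<forall>\<^sub>F h in at_right 0. \<forall>\<^sub>F N in sequentially. \<forall>s.
           cmod ((\<Sum>j<N. f (s - real j * h)) / of_nat N - L) < \<epsilon>"
proof -
  obtain g m where gm: "trig_poly g m" "\<And>t. cmod (f t - g t) \<le> \<epsilon> / 4" "cmod (m - L) \<le> \<epsilon> / 4"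
    using assms unfolding ap_mean_def by (metis zero_less_divide_iff zero_less_numeral)
  show ?thesis using trig_poly_discrete_mean[OF gm(1)]
  proof eventually_elim
    case (elim h)
    then have "\<forall>\<^sub>F N in sequentially. \<forall>s\<in>UNIV. dist ((\<Sum>j<N. g (s - real j * h)) / of_nat N) m < \<epsilon> / 4"
      using assms(2) by (auto dest!: uniform_limitD[where e = "\<epsilon> / 4"])
    then show ?case using eventually_gt_at_top[of 0]
    proof eventually_elim
      case (elim N)
      show ?case
      proof
        fix s
        let ?A = "\<lambda>f::real \<Rightarrow> complex. (\<Sum>j<N. f (s - real j * h)) / of_nat N"
        have "?A f - ?A g = ?A (\<lambda>t. f t - g t)" by (simp add: sum_subtractf diff_divide_distrib)
        moreover have "cmod (\<Sum>j<N. f (s - real j * h) - g (s - real j * h)) \<le> real (card {..<N}) * (\<epsilon> / 4)"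
          by (rule sum_norm_bound) (use gm in auto)
        ultimately have 1: "cmod (?A f - ?A g) \<le> \<epsilon> / 4"
          using elim by (simp add: norm_divide field_simps)
        have 2: "cmod (?A g - m) < \<epsilon> / 4" using elim by (auto simp: dist_norm)
        have "cmod (?A f - L) \<le> cmod (?A f - ?A g) + (cmod (?A g - m) + cmod (m - L))"
          using norm_triangle_ineq[of "?A f - ?A g" "?A g - L"] norm_triangle_ineq[of "?A g - m" "m - L"]
          by simp
        then show "cmod (?A f - L) < \<epsilon>" using 1 2 gm(3) assms(2) by linarith
      qed
    qed
  qed
qed

lemma ap_mean_integral:
  assumes "ap_mean f L" "continuous_on UNIV f"
  shows "((\<lambda>T. integral {-T..T} f / of_real (2 * T)) \<longlongrightarrow> L) at_top"
proof (rule tendstoI)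
  fix \<epsilon> :: real assume "\<epsilon> > 0"
  then obtain g m where gm: "trig_poly g m" "\<And>t. cmod (f t - g t) \<le> \<epsilon> / 4" "cmod (m - L) \<le> \<epsilon> / 4"
    using assms unfolding ap_mean_def by (metis zero_less_divide_iff zero_less_numeral)
  have "\<forall>\<^sub>F T in at_top. dist (integral {-T..T} g / of_real (2 * T)) m < \<epsilon> / 4"
    using trig_poly_integral_mean[OF gm(1)] by (rule tendstoD) (use \<open>\<epsilon> > 0\<close> in simp)
  then show "\<forall>\<^sub>F T in at_top. dist (integral {-T..T} f / of_real (2 * T)) L < \<epsilon>"
    using eventually_gt_at_top[of 0]
  proof eventually_elim
    case (elim T)
    have int: "f integrable_on {-T..T}" "g integrable_on {-T..T}"
      using assms(2) trig_poly_continuous[OF gm(1)]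
      by (auto intro!: integrable_continuous_interval intro: continuous_on_subset)
    let ?A = "\<lambda>f. integral {-T..T} f / complex_of_real (2 * T)"
    have "cmod (integral {-T..T} (\<lambda>t. f t - g t)) \<le> \<epsilon> / 4 * (T - (-T))"
      by (rule integral_bound) (use elim gm(2) assms(2) trig_poly_continuous[OF gm(1)] in
          \<open>auto intro!: continuous_intros intro: continuous_on_subset\<close>)
    then have "cmod (?A f - ?A g) \<le> \<epsilon> / 4"
      using elim int by (simp add: integral_diff diff_divide_distrib[symmetric] norm_divide norm_mult field_simps)
    moreover have "cmod (?A f - L) \<le> cmod (?A f - ?A g) + (cmod (?A g - m) + cmod (m - L))"
      using norm_triangle_ineq[of "?A f - ?A g" "?A g - L"] norm_triangle_ineq[of "?A g - m" "m - L"]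
      by simp
    ultimately show ?case using elim gm(3) \<open>\<epsilon> > 0\<close> unfolding dist_norm by linarith
  qed
qed

text \<open>
  Trigonometric polynomials are an algebra, which is what makes the polynomial approximations
  below produce trigonometric polynomials again.
\<close>

lemma trig_poly_real_polynomial:
  fixes p :: "real \<Rightarrow> real"
  assumes "real_polynomial_function p" and f: "trig_poly (\<lambda>t. of_real (f t)) m"
  shows "\<exists>k. trig_poly (\<lambda>t. of_real (p (f t))) k"
  using assms(1)
proof induction
  case (linear q)
  have "q x = q 1 * x" for x
    using linear_simps(5)[OF linear, of x 1] by (simp add: mult.commute)
  then have "complex_of_real (q (f t)) = of_real (q 1) * of_real (f t)" for t
    by (metis of_real_mult)
  then show ?case using trig_poly_cmult[OF f, of "of_real (q 1)"] by (simp only:) blast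
next
  case (const c)
  then show ?case using trig_poly_const by blast
next
  case (add p q)
  then show ?case by (auto dest: trig_poly.add)
next
  case (mult p q)
  then show ?case by (auto dest: trig_poly_mult)
qed

text \<open>
  Applied to \<open>y = |D|\<close>, a polynomial \<open>q\<close> with \<open>q(x)\<close> close to \<open>1/\<surd>x\<close> serves two purposes:
  \<open>|D|\<^sup>2 q(|D|\<^sup>2)\<close> approximates \<open>|D|\<close> uniformly, and \<open>D q(|D|\<^sup>2)\<close> is a substitute for the sign
  \<open>D/|D|\<close> which stays in the unit ball and remains a trigonometric polynomial.
\<close>

lemma polynomial_sign_approximation:
  fixes B \<epsilon> :: real
  assumes "\<epsilon> > 0"
  shows "\<exists>q. real_polynomial_function q \<and>
           (\<forall>y. 0 \<le> y \<and> y \<le> B \<longrightarrow> \<bar>y\<^sup>2 * q (y\<^sup>2) - y\<bar> \<le> \<epsilon> \<and> \<bar>y * q (y\<^sup>2)\<bar> \<le> 1)"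
proof (cases "B \<ge> 0")
  case True
  (* q approximates 1 / (sqrt x + a): the shift a removes the singularity at 0, costs at most a in
     the first estimate, and leaves the room a / (y + a) below 1 in the second one.  The error
     \<delta> of the approximation has to fit into that room. *)
  define a where "a = \<epsilon> / 2"
  define \<delta> where "\<delta> = min (a / ((B + 1) * (B + a))) (a / (B\<^sup>2 + 1))"
  have a: "a > 0" using assms by (simp add: a_def)
  have B2: "B\<^sup>2 + 1 > 0" by (smt (verit) zero_le_power2)
  have \<delta>: "\<delta> > 0" using a True B2 by (simp add: \<delta>_def)
  have "continuous_on {0..B\<^sup>2} (\<lambda>x. 1 / (sqrt x + a))"
    using a by (intro continuous_intros) (auto simp: add_nonneg_eq_0_iff)
  then obtain q where q: "real_polynomial_function q"
      "\<And>x. x \<in> {0..B\<^sup>2} \<Longrightarrow> \<bar>1 / (sqrt x + a) - q x\<bar> < \<delta>"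
    using Stone_Weierstrass_real_polynomial_function[OF compact_Icc _ \<delta>] by blast
  have "\<bar>y\<^sup>2 * q (y\<^sup>2) - y\<bar> \<le> \<epsilon> \<and> \<bar>y * q (y\<^sup>2)\<bar> \<le> 1" if y: "0 \<le> y" "y \<le> B" for y
  proof -
    have "\<bar>1 / (y + a) - q (y\<^sup>2)\<bar> < \<delta>" using q(2)[of "y\<^sup>2"] y by (simp add: power_mono)
    then obtain r where r: "q (y\<^sup>2) = 1 / (y + a) + r" "\<bar>r\<bar> \<le> \<delta>"
      by (metis abs_minus_commute add_diff_cancel_left' add.commute diff_add_cancel less_imp_le)
    have pos: "y + a > 0" using y a by simp
    have "y * \<bar>r\<bar> \<le> B * (a / ((B + 1) * (B + a)))"
      using y r(2) True by (intro mult_mono) (auto simp: \<delta>_def)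
    also have "\<dots> = (B / (B + 1)) * (a / (B + a))" by simp
    also have "\<dots> \<le> 1 * (a / (y + a))"
      using y a True by (intro mult_mono frac_le) auto
    finally have yr: "\<bar>y * r\<bar> \<le> a / (y + a)" using y by (simp add: abs_mult)
    have one: "y / (y + a) + a / (y + a) = 1" using pos by (simp flip: add_divide_distrib)
    have "a / (y + a) \<le> 1" "0 \<le> y / (y + a)" using y pos by auto
    then have 1: "\<bar>y * q (y\<^sup>2)\<bar> \<le> 1"
      using yr one unfolding r(1) by (simp add: distrib_left abs_le_iff)
    have "y\<^sup>2 * \<bar>r\<bar> \<le> B\<^sup>2 * (a / (B\<^sup>2 + 1))"
      using y r(2) by (intro mult_mono power_mono) (auto simp: \<delta>_def)
    also have "\<dots> \<le> a" using a B2 by (simp add: field_simps)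
    finally have 2: "\<bar>y\<^sup>2 * r\<bar> \<le> a" by (simp add: abs_mult)
    have "y\<^sup>2 * (1 / (y + a)) - y = - (a * (y / (y + a)))"
    proof -
      have "(y + a) * (y / (y + a)) = y" using pos by simp
      then show ?thesis by (simp add: power2_eq_square algebra_simps add_divide_distrib)
    qed
    moreover have "y / (y + a) \<le> 1" "0 \<le> y / (y + a)" using a y pos by auto
    then have "a * (y / (y + a)) \<le> a * 1" "0 \<le> a * (y / (y + a))"
      using a by (intro mult_left_mono mult_nonneg_nonneg; simp)+
    moreover have "y\<^sup>2 * q (y\<^sup>2) - y = (y\<^sup>2 * (1 / (y + a)) - y) + y\<^sup>2 * r"
      unfolding r(1) by (simp add: algebra_simps)
    ultimately have "\<bar>y\<^sup>2 * q (y\<^sup>2) - y\<bar> \<le> \<epsilon>"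
      using 2 a_def by linarith
    with 1 show ?thesis by simp
  qed
  with q(1) show ?thesis by blast
next
  case False
  then show ?thesis by (intro exI[of _ "\<lambda>_. 0"]) auto
qed

section \<open>The Hahn-Banach theorem\<close>

lemma complex_field_simps [simp]:
  "carrier complex_field = UNIV" "mult complex_field = (*)" "one complex_field = 1"
  "zero complex_field = 0" "add complex_field = (+)"
  by (simp_all add: complex_field_def)

locale complex_vector_space = module complex_field Y for Y :: "(complex, 'b, 'c) module_scheme" (structure)
begin

abbreviation rsmult :: "real \<Rightarrow> 'b \<Rightarrow> 'b" (infixr "\<cdot>" 75) where
  "t \<cdot> x \<equiv> complex_of_real t \<odot> x"

definition sublinear :: "('b \<Rightarrow> real) \<Rightarrow> bool" where
  "sublinear q \<longleftrightarrow>
     (\<forall>x\<in>carrier Y. \<forall>y\<in>carrier Y. q (x \<oplus> y) \<le> q x + q y) \<and>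
     (\<forall>t>0. \<forall>x\<in>carrier Y. q (t \<cdot> x) = t * q x)"

lemma smult_distribs:
  assumes "x \<in> carrier Y"
  shows "(a + b) \<odot> x = a \<odot> x \<oplus> b \<odot> x" "(a * b) \<odot> x = a \<odot> (b \<odot> x)" "1 \<odot> x = x" "0 \<odot> x = \<zero>"
  using smult_l_distr[of a b x] smult_assoc1[of a b x] smult_one[of x] smult_l_null[of x] assms
  by simp_all

lemma smult_add: "x \<in> carrier Y \<Longrightarrow> y \<in> carrier Y \<Longrightarrow> a \<odot> (x \<oplus> y) = a \<odot> x \<oplus> a \<odot> y"
  using smult_r_distr[of a x y] by simp

lemma smult_in: "x \<in> carrier Y \<Longrightarrow> a \<odot> x \<in> carrier Y"
  using smult_closed[of a x] by simp

lemma sublinear_zero: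
  assumes "sublinear q"
  shows "q \<zero> = 0"
proof -
  have "q (2 \<cdot> \<zero>) = 2 * q \<zero>"
    using assms zero_closed unfolding sublinear_def by (metis zero_less_numeral)
  moreover have "2 \<cdot> \<zero> = \<zero>" using smult_r_null by simp
  ultimately show ?thesis by (simp del: of_real_numeral)
qed

lemma sublinear_minus:
  assumes "sublinear q" "x \<in> carrier Y"
  shows "0 \<le> q x + q (\<ominus> x)"
  using assms sublinear_zero[OF assms(1)] r_neg[OF assms(2)]
  by (metis sublinear_def a_inv_closed)

text \<open>
  This construction decreases a sublinear functional so that it respects prescribed values \<open>v\<close> on a
  convex cone \<open>K\<close>.  With \<open>K\<close> a subspace it turns a dominated functional on \<open>K\<close> into a sublinear
  functional that every linear minorant must match on \<open>K\<close>; with \<open>K\<close> a ray and \<open>v = q\<close> it shows that minimal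
  sublinear functionals are additive.
\<close>

lemma inf_convolution:
  assumes q: "sublinear q"
    and K: "K \<subseteq> carrier Y" "\<zero> \<in> K" "\<And>k l. k \<in> K \<Longrightarrow> l \<in> K \<Longrightarrow> k \<oplus> l \<in> K"
      "\<And>t k. t > 0 \<Longrightarrow> k \<in> K \<Longrightarrow> t \<cdot> k \<in> K"
    and v: "\<And>k l. k \<in> K \<Longrightarrow> l \<in> K \<Longrightarrow> v (k \<oplus> l) = v k + v l"
      "\<And>t k. t > 0 \<Longrightarrow> k \<in> K \<Longrightarrow> v (t \<cdot> k) = t * v k"
      "\<And>k. k \<in> K \<Longrightarrow> v k \<le> q k"
  shows "\<exists>q'. sublinear q' \<and> (\<forall>x\<in>carrier Y. \<forall>k\<in>K. q' x \<le> q (x \<oplus> k) - v k)"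
proof (intro exI conjI ballI)
  let ?q = "\<lambda>x. INF k\<in>K. q (x \<oplus> k) - v k"
  have bdd: "bdd_below ((\<lambda>k. q (x \<oplus> k) - v k) ` K)" if x: "x \<in> carrier Y" for x
  proof (rule bdd_belowI2)
    fix k assume k: "k \<in> K"
    then have kY: "k \<in> carrier Y" using K by auto
    have "q ((x \<oplus> k) \<oplus> \<ominus> x) \<le> q (x \<oplus> k) + q (\<ominus> x)"
      using q x kY by (simp add: sublinear_def)
    moreover have "(x \<oplus> k) \<oplus> \<ominus> x = k" using x kY by (simp add: a_ac r_neg2 r_neg1 M.r_neg)
    ultimately show "- q (\<ominus> x) \<le> q (x \<oplus> k) - v k" using v(3)[OF k] by simp
  qed
  show le: "?q x \<le> q (x \<oplus> k) - v k" if "x \<in> carrier Y" "k \<in> K" for x k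
    by (rule cINF_lower[OF bdd]) (use that in auto)
  have ne: "K \<noteq> {}" using K by auto
  have sub: "?q (x \<oplus> y) \<le> ?q x + ?q y" if xy: "x \<in> carrier Y" "y \<in> carrier Y" for x y
  proof -
    have *: "?q (x \<oplus> y) \<le> (q (x \<oplus> k) - v k) + (q (y \<oplus> l) - v l)" if kl: "k \<in> K" "l \<in> K" for k l
    proof -
      have c: "k \<in> carrier Y" "l \<in> carrier Y" using kl K by auto
      have "?q (x \<oplus> y) \<le> q ((x \<oplus> y) \<oplus> (k \<oplus> l)) - v (k \<oplus> l)"
        using xy kl K by (intro le) auto
      also have "(x \<oplus> y) \<oplus> (k \<oplus> l) = (x \<oplus> k) \<oplus> (y \<oplus> l)" using xy c by (simp add: a_ac)
      also have "q ((x \<oplus> k) \<oplus> (y \<oplus> l)) \<le> q (x \<oplus> k) + q (y \<oplus> l)"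
        using q xy c by (simp add: sublinear_def)
      finally show ?thesis using v(1)[OF kl] by simp
    qed
    have "?q (x \<oplus> y) - (q (y \<oplus> l) - v l) \<le> ?q x" if "l \<in> K" for l
      by (rule cINF_greatest[OF ne]) (use *[OF _ that] in \<open>simp add: algebra_simps\<close>)
    then have "?q (x \<oplus> y) - ?q x \<le> ?q y"
      by (intro cINF_greatest[OF ne]) (simp add: algebra_simps)
    then show ?thesis by simp
  qed
  have hom_le: "?q (t \<cdot> x) \<le> t * ?q x" if tx: "t > 0" "x \<in> carrier Y" for t x
  proof -
    have "?q (t \<cdot> x) / t \<le> q (x \<oplus> k) - v k" if k: "k \<in> K" for k
    proof -
      have c: "k \<in> carrier Y" using k K by auto
      have "?q (t \<cdot> x) \<le> q (t \<cdot> x \<oplus> t \<cdot> k) - v (t \<cdot> k)"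
        using tx k K by (intro le) (auto intro: smult_in)
      also have "t \<cdot> x \<oplus> t \<cdot> k = t \<cdot> (x \<oplus> k)" using tx c by (simp add: smult_add)
      also have "q \<dots> = t * q (x \<oplus> k)" using q tx c by (simp add: sublinear_def)
      finally show ?thesis using v(2)[OF tx(1) k] tx(1) by (simp add: field_simps)
    qed
    then have "?q (t \<cdot> x) / t \<le> ?q x" by (intro cINF_greatest[OF ne])
    then show ?thesis using tx(1) by (simp add: field_simps)
  qed
  have "?q (t \<cdot> x) = t * ?q x" if tx: "t > 0" "x \<in> carrier Y" for t x
  proof (rule antisym[OF hom_le[OF tx]])
    have "(1 / t) \<cdot> (t \<cdot> x) = x"
      using smult_distribs(2)[OF tx(2), of "of_real (1/t)" "of_real t"] smult_distribs(3)[OF tx(2)] tx(1)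
      by (simp flip: of_real_mult)
    then have "?q x \<le> 1 / t * ?q (t \<cdot> x)"
      using hom_le[of "1 / t" "t \<cdot> x"] tx by (auto simp: smult_in)
    then show "t * ?q x \<le> ?q (t \<cdot> x)" using tx(1) by (simp add: field_simps)
  qed
  with sub show "sublinear ?q" unfolding sublinear_def by blast
qed

text \<open>
  Zorn's lemma applies because every sublinear functional below \<open>p\<close> is bounded below by
  \<open>- p (\<ominus> x)\<close>, and pointwise infima of chains are sublinear.
\<close>

lemma minimal_sublinear:
  assumes p: "sublinear p"
  shows "\<exists>q. sublinear q \<and> (\<forall>x\<in>carrier Y. q x \<le> p x) \<and>
           (\<forall>r. sublinear r \<longrightarrow> (\<forall>x\<in>carrier Y. r x \<le> q x) \<longrightarrow> (\<forall>x\<in>carrier Y. r x = q x))"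
proof -
  (* Values outside the carrier are fixed to 0 so that the pointwise order is antisymmetric. *)
  define A where "A = {q. sublinear q \<and> (\<forall>x\<in>carrier Y. q x \<le> p x) \<and> (\<forall>x. x \<notin> carrier Y \<longrightarrow> q x = 0)}"
  define restr where "restr q = (\<lambda>x. if x \<in> carrier Y then q x else (0::real))" for q
  have restr_sub: "sublinear (restr q) \<longleftrightarrow> sublinear q" for q
    unfolding sublinear_def restr_def by (simp add: smult_in)
  have restr_A: "restr q \<in> A" if "sublinear q" "\<forall>x\<in>carrier Y. q x \<le> p x" for q
    using that restr_sub by (simp add: A_def) (simp add: restr_def)
  have "\<exists>q\<in>A. \<forall>r\<in>A. r \<le> q \<longrightarrow> r = q"
  proof (rule predicate_Zorn[where P = "\<lambda>a b. b \<le> a"])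
    show "partial_order_on A (relation_of (\<lambda>a b. b \<le> a) A)"
      by (rule partial_order_on_relation_ofI) auto
    fix C assume "C \<in> Chains (relation_of (\<lambda>a b. b \<le> a) A)"
    then have CA: "C \<subseteq> A" and chain: "\<And>a b. a \<in> C \<Longrightarrow> b \<in> C \<Longrightarrow> a \<le> b \<or> b \<le> a"
      by (auto simp: Chains_def relation_of_def)
    show "\<exists>u\<in>A. \<forall>a\<in>C. u \<le> a"
    proof (cases "C = {}")
      case True
      then show ?thesis using restr_A[OF p] by auto
    next
      case ne: False
      let ?u = "\<lambda>x. INF q\<in>C. q x"
      have bdd: "bdd_below ((\<lambda>q. q x) ` C)" if x: "x \<in> carrier Y" for x
      proof (rule bdd_belowI2)
        fix q assume "q \<in> C"
        then have q: "sublinear q" "\<forall>x\<in>carrier Y. q x \<le> p x" using CA by (auto simp: A_def)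
        show "- p (\<ominus> x) \<le> q x"
          using sublinear_minus[OF q(1) x] q(2)[rule_format, of "\<ominus> x"] x by simp
      qed
      have le: "?u x \<le> q x" if "x \<in> carrier Y" "q \<in> C" for x q
        by (rule cINF_lower[OF bdd]) (use that in auto)
      have "?u (x \<oplus> y) \<le> ?u x + ?u y" if xy: "x \<in> carrier Y" "y \<in> carrier Y" for x y
      proof -
        have *: "?u (x \<oplus> y) \<le> q x + r y" if qr: "q \<in> C" "r \<in> C" for q r
        proof -
          obtain s where s: "s \<in> C" "s \<le> q" "s \<le> r" using chain[OF qr] qr by blast
          then have "s (x \<oplus> y) \<le> s x + s y" using CA xy by (auto simp: A_def sublinear_def)
          then show ?thesis using le[of "x \<oplus> y" s] s xy le_funD[OF s(2), of x] le_funD[OF s(3), of y]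
            by (simp add: order.trans)
        qed
        have "?u (x \<oplus> y) - r y \<le> ?u x" if "r \<in> C" for r
          by (rule cINF_greatest[OF ne]) (use *[OF _ that] in \<open>simp add: algebra_simps\<close>)
        then have "?u (x \<oplus> y) - ?u x \<le> ?u y"
          by (intro cINF_greatest[OF ne]) (simp add: algebra_simps)
        then show ?thesis by simp
      qed
      moreover have "?u (t \<cdot> x) = t * ?u x" if tx: "t > 0" "x \<in> carrier Y" for t x
      proof -
        have hom: "q (t \<cdot> x) = t * q x" if "q \<in> C" for q
          using that CA tx by (auto simp: A_def sublinear_def)
        have tx': "t \<cdot> x \<in> carrier Y" using tx smult_in by simp
        show ?thesis
        proof (rule antisym)
          have "?u (t \<cdot> x) / t \<le> ?u x"
            by (rule cINF_greatest[OF ne]) (use le[OF tx'] hom tx in \<open>auto simp: field_simps\<close>)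
          then show "?u (t \<cdot> x) \<le> t * ?u x" using tx by (simp add: field_simps)
          show "t * ?u x \<le> ?u (t \<cdot> x)"
            using tx(1) by (intro cINF_greatest[OF ne]) (simp only: hom, intro mult_left_mono le[OF tx(2)], auto)
        qed
      qed
      ultimately have "sublinear ?u" unfolding sublinear_def by blast
      moreover have "\<forall>x\<in>carrier Y. ?u x \<le> p x"
        using ne le CA unfolding A_def by (smt (verit, best) ex_in_conv mem_Collect_eq subsetD)
      ultimately have "restr ?u \<in> A" by (rule restr_A)
      moreover have "restr ?u \<le> a" if "a \<in> C" for a
        using that le CA by (auto simp: le_fun_def restr_def A_def)
      ultimately show ?thesis by blast
    qed
  qed
  then obtain q where q: "q \<in> A" "\<And>r. r \<in> A \<Longrightarrow> r \<le> q \<Longrightarrow> r = q" by blast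
  have "\<forall>x\<in>carrier Y. r x = q x" if r: "sublinear r" "\<forall>x\<in>carrier Y. r x \<le> q x" for r
  proof -
    have "\<forall>x\<in>carrier Y. r x \<le> p x" using r(2) q(1) by (force simp: A_def)
    moreover have "restr r \<le> q" using r(2) q(1) by (auto simp: le_fun_def restr_def A_def)
    ultimately have "restr r = q" using q(2) restr_A r(1) by blast
    then show ?thesis by (auto simp: restr_def)
  qed
  with q(1) show ?thesis unfolding A_def by blast
qed

text \<open>
  Inf-convolution along the ray through \<open>y\<close> gives a sublinear functional \<open>r\<close> below \<open>q\<close> with
  \<open>r x \<le> q (x \<oplus> y) - q y\<close>; minimality forces \<open>r = q\<close>, which is superadditivity.
\<close>

lemma minimal_sublinear_additive:
  assumes q: "sublinear q"
    and min: "\<And>r. sublinear r \<Longrightarrow> \<forall>x\<in>carrier Y. r x \<le> q x \<Longrightarrow> \<forall>x\<in>carrier Y. r x = q x"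
    and xy: "x \<in> carrier Y" "y \<in> carrier Y"
  shows "q (x \<oplus> y) = q x + q y"
proof (rule antisym)
  show "q (x \<oplus> y) \<le> q x + q y" using q xy by (simp add: sublinear_def)
  let ?K = "{t \<cdot> y | t. t \<ge> 0}"
  have hom: "q (t \<cdot> y) = t * q y" if "t \<ge> 0" for t
    using that q xy smult_distribs(4)[OF xy(2)] sublinear_zero[OF q]
    by (cases "t = 0") (auto simp: sublinear_def)
  have plus: "t \<cdot> y \<oplus> s \<cdot> y = (t + s) \<cdot> y" for t s
    using smult_distribs(1)[OF xy(2)] by simp
  have times: "t \<cdot> (s \<cdot> y) = (t * s) \<cdot> y" for t s
    using smult_distribs(2)[OF xy(2)] by simp
  have "\<exists>r. sublinear r \<and> (\<forall>x\<in>carrier Y. \<forall>k\<in>?K. r x \<le> q (x \<oplus> k) - q k)"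
  proof (rule inf_convolution[OF q])
    show "?K \<subseteq> carrier Y" using xy smult_in by auto
    show "\<zero> \<in> ?K" using smult_distribs(4)[OF xy(2)] by (force intro: exI[of _ 0])
    show "k \<oplus> l \<in> ?K" if "k \<in> ?K" "l \<in> ?K" for k l
      using that plus by (auto simp del: of_real_add)
    show "t \<cdot> k \<in> ?K" if "t > 0" "k \<in> ?K" for t k
      using that times by (auto simp del: of_real_mult)
    show "q (k \<oplus> l) = q k + q l" if "k \<in> ?K" "l \<in> ?K" for k l
      using that by (auto simp: plus hom distrib_right simp del: of_real_add)
    show "q (t \<cdot> k) = t * q k" if "t > 0" "k \<in> ?K" for t k
      using that q xy smult_in by (auto simp: sublinear_def)
  qed simp
  then obtain r where r: "sublinear r" "\<And>x k. x \<in> carrier Y \<Longrightarrow> k \<in> ?K \<Longrightarrow> r x \<le> q (x \<oplus> k) - q k"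
    by blast
  have "\<zero> \<in> ?K" using smult_distribs(4)[OF xy(2)] by (force intro: exI[of _ 0])
  then have "\<forall>x\<in>carrier Y. r x \<le> q x" using r(2)[of _ \<zero>] sublinear_zero[OF q] by auto
  then have "r x = q x" using min[OF r(1)] xy by blast
  moreover have "y \<in> ?K" using smult_distribs(3)[OF xy(2)] by (force intro: exI[of _ 1])
  ultimately show "q x + q y \<le> q (x \<oplus> y)" using r(2)[OF xy(1), of y] by simp
qed

definition linear_functional :: "('b \<Rightarrow> complex) \<Rightarrow> bool" where
  "linear_functional \<phi> \<longleftrightarrow>
     (\<forall>x\<in>carrier Y. \<forall>y\<in>carrier Y. \<phi> (x \<oplus> y) = \<phi> x + \<phi> y) \<and>
     (\<forall>c. \<forall>x\<in>carrier Y. \<phi> (c \<odot> x) = c * \<phi> x)"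

lemma real_hahn_banach:
  assumes p: "sublinear p"
    and S: "S \<subseteq> carrier Y" "\<zero> \<in> S" "\<And>x y. x \<in> S \<Longrightarrow> y \<in> S \<Longrightarrow> x \<oplus> y \<in> S"
      "\<And>t x. x \<in> S \<Longrightarrow> t \<cdot> x \<in> S"
    and u: "\<And>x y. x \<in> S \<Longrightarrow> y \<in> S \<Longrightarrow> u (x \<oplus> y) = u x + u y"
      "\<And>t x. x \<in> S \<Longrightarrow> u (t \<cdot> x) = t * u x"
      "\<And>x. x \<in> S \<Longrightarrow> u x \<le> p x"
  shows "\<exists>q. (\<forall>x\<in>carrier Y. \<forall>y\<in>carrier Y. q (x \<oplus> y) = q x + q y) \<and>
             (\<forall>t. \<forall>x\<in>carrier Y. q (t \<cdot> x) = t * q x) \<and>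
             (\<forall>x\<in>carrier Y. q x \<le> p x) \<and> (\<forall>x\<in>S. q x = u x)"
proof -
  have u0: "u \<zero> = 0" using u(2)[OF S(2), of 0] smult_r_null[of 0] by simp
  obtain p' where p': "sublinear p'"
      "\<And>x k. x \<in> carrier Y \<Longrightarrow> k \<in> S \<Longrightarrow> p' x \<le> p (x \<oplus> k) - u k"
    using inf_convolution[OF p S(1-4) u] by blast
  obtain q where q: "sublinear q" "\<And>x. x \<in> carrier Y \<Longrightarrow> q x \<le> p' x"
      "\<And>r. sublinear r \<Longrightarrow> \<forall>x\<in>carrier Y. r x \<le> q x \<Longrightarrow> \<forall>x\<in>carrier Y. r x = q x"
    using minimal_sublinear[OF p'(1)] by blast
  have add: "q (x \<oplus> y) = q x + q y" if "x \<in> carrier Y" "y \<in> carrier Y" for x y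
    using minimal_sublinear_additive[OF q(1) q(3)] that by blast
  have minus: "q (\<ominus> x) = - q x" if "x \<in> carrier Y" for x
    using add[of x "\<ominus> x"] that r_neg[of x] sublinear_zero[OF q(1)] by simp
  have neg: "(-1) \<cdot> x = \<ominus> x" if x: "x \<in> carrier Y" for x
  proof -
    have "(-1) \<cdot> x \<oplus> x = \<zero>"
      using smult_distribs(1)[OF x, of "-1" 1] smult_distribs(3,4)[OF x] by simp
    then show ?thesis using x smult_in minus_equality by simp
  qed
  have hom: "q (t \<cdot> x) = t * q x" if x: "x \<in> carrier Y" for t x
  proof (cases t "0::real" rule: linorder_cases)
    case less
    then have "q ((-t) \<cdot> x) = (-t) * q x"
      using q(1) x by (simp add: sublinear_def del: of_real_minus)
    moreover have "t \<cdot> x = (-1) \<cdot> ((-t) \<cdot> x)"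
      using smult_distribs(2)[OF x, of "of_real (-1)" "of_real (-t)"] by simp
    ultimately show ?thesis using neg minus x smult_in by simp
  next
    case equal
    then show ?thesis using sublinear_zero[OF q(1)] smult_distribs(4)[OF x] by simp
  next
    case greater
    then show ?thesis using q(1) x by (simp add: sublinear_def)
  qed
  have le: "q x \<le> p x" if "x \<in> carrier Y" for x
    using q(2)[OF that] p'(2)[OF that S(2)] u0 that by simp
  have eq: "q x = u x" if x: "x \<in> S" for x
  proof -
    have lower: "u k \<le> q k" if k: "k \<in> S" for k
    proof -
      have kY: "k \<in> carrier Y" using k S by auto
      have "q (\<ominus> k) \<le> p (\<ominus> k \<oplus> k) - u k"
        using q(2)[of "\<ominus> k"] p'(2)[of "\<ominus> k" k] k kY by simp
      then show ?thesis using minus[OF kY] l_neg[OF kY] sublinear_zero[OF p] by simp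
    qed
    have xY: "x \<in> carrier Y" using x S by auto
    have "u ((-1) \<cdot> x) \<le> q ((-1) \<cdot> x)" using lower S(4) x by blast
    then show ?thesis using lower[OF x] hom[OF xY, of "-1"] u(2)[OF x, of "-1"] by simp
  qed
  show ?thesis using add hom le eq by blast
qed

text \<open>
  A complex linear functional is determined by its real part \<open>q\<close> through
  \<open>F x = q x - \<i> q (\<i> \<odot> x)\<close>, so the real part of \<open>f\<close> is what has to be extended.
\<close>

lemma complex_hahn_banach:
  assumes p: "\<And>x y. x \<in> carrier Y \<Longrightarrow> y \<in> carrier Y \<Longrightarrow> p (x \<oplus> y) \<le> p x + p y"
      "\<And>c x. x \<in> carrier Y \<Longrightarrow> p (c \<odot> x) = cmod c * p x"
    and S: "S \<subseteq> carrier Y" "S \<noteq> {}" "\<And>x y. x \<in> S \<Longrightarrow> y \<in> S \<Longrightarrow> x \<oplus> y \<in> S"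
      "\<And>c x. x \<in> S \<Longrightarrow> c \<odot> x \<in> S"
    and f: "\<And>x y. x \<in> S \<Longrightarrow> y \<in> S \<Longrightarrow> f (x \<oplus> y) = f x + f y"
      "\<And>c x. x \<in> S \<Longrightarrow> f (c \<odot> x) = c * f x"
      "\<And>x. x \<in> S \<Longrightarrow> cmod (f x) \<le> p x"
  shows "\<exists>F. linear_functional F \<and> (\<forall>x\<in>carrier Y. cmod (F x) \<le> p x) \<and> (\<forall>x\<in>S. F x = f x)"
proof -
  have subl: "sublinear p" using p by (simp add: sublinear_def)
  obtain s where s: "s \<in> S" using S(2) by auto
  then have S0: "\<zero> \<in> S" using S(4)[OF s, of 0] smult_distribs(4)[of s] S(1) by auto
  have "\<exists>q. (\<forall>x\<in>carrier Y. \<forall>y\<in>carrier Y. q (x \<oplus> y) = q x + q y) \<and>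
             (\<forall>t. \<forall>x\<in>carrier Y. q (t \<cdot> x) = t * q x) \<and>
             (\<forall>x\<in>carrier Y. q x \<le> p x) \<and> (\<forall>x\<in>S. q x = Re (f x))"
  proof (rule real_hahn_banach[OF subl S(1) S0 S(3,4)])
    show "Re (f x) \<le> p x" if "x \<in> S" for x
      using f(3)[OF that] complex_Re_le_cmod[of "f x"] by simp
  qed (use f in auto)
  then obtain q where q: "\<And>x y. x \<in> carrier Y \<Longrightarrow> y \<in> carrier Y \<Longrightarrow> q (x \<oplus> y) = q x + q y"
      "\<And>t x. x \<in> carrier Y \<Longrightarrow> q (t \<cdot> x) = t * q x"
      "\<And>x. x \<in> carrier Y \<Longrightarrow> q x \<le> p x" "\<And>x. x \<in> S \<Longrightarrow> q x = Re (f x)"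
    by blast
  define F where "F x = Complex (q x) (- q (\<i> \<odot> x))" for x
  have F_add: "F (x \<oplus> y) = F x + F y" if "x \<in> carrier Y" "y \<in> carrier Y" for x y
    using that by (simp add: F_def complex_eq_iff smult_add smult_in q(1))
  have F_smult: "F (c \<odot> x) = c * F x" if x: "x \<in> carrier Y" for c x
  proof -
    define a b where "a = Re c" and "b = Im c"
    have c: "c = of_real a + of_real b * \<i>" by (simp add: a_def b_def complex_eq_iff)
    have ix: "\<i> \<odot> x \<in> carrier Y" using x smult_in by simp
    have 1: "c \<odot> x = a \<cdot> x \<oplus> b \<cdot> (\<i> \<odot> x)"
      by (subst c) (simp only: smult_distribs(1,2)[OF x])
    have "\<i> * c = of_real a * \<i> + of_real (- b)" by (simp add: complex_eq_iff a_def b_def)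
    then have 2: "\<i> \<odot> (c \<odot> x) = a \<cdot> (\<i> \<odot> x) \<oplus> (- b) \<cdot> x"
      by (simp only: smult_distribs(1,2)[OF x, symmetric])
    have "q (c \<odot> x) = a * q x + b * q (\<i> \<odot> x)"
      unfolding 1 using x ix by (simp add: q(1,2) smult_in)
    moreover have "q (\<i> \<odot> (c \<odot> x)) = a * q (\<i> \<odot> x) - b * q x"
      unfolding 2 using x ix q(2)[of x "-b"] by (simp add: q(1,2) smult_in del: of_real_minus)
    ultimately show ?thesis by (simp add: F_def complex_eq_iff a_def b_def algebra_simps)
  qed
  have "cmod (F x) \<le> p x" if x: "x \<in> carrier Y" for x
  proof -
    (* Rotate x so that the value of F becomes real; there it agrees with q. *)
    define c where "c = cis (- Arg (F x))"
    have "c * F x = of_real (cmod (F x))"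
      using rcis_cmod_Arg[of "F x"] unfolding c_def rcis_def
      by (metis (no_types, lifting) add.left_inverse cis_mult cis_zero mult.left_commute mult.right_neutral)
    then have "cmod (F x) = Re (F (c \<odot> x))" using F_smult[OF x] by simp
    also have "\<dots> = q (c \<odot> x)" by (simp add: F_def)
    also have "\<dots> \<le> p (c \<odot> x)" using q(3) x smult_in by simp
    also have "\<dots> = p x" using p(2)[OF x] by (simp add: c_def)
    finally show ?thesis .
  qed
  moreover have "F x = f x" if "x \<in> S" for x
    using that q(4) S(4)[of x \<i>] f(2)[of x \<i>] by (simp add: F_def complex_eq_iff)
  ultimately show ?thesis
    using F_add F_smult unfolding linear_functional_def by blast
qed

end

section \<open>The Dirichlet kernel and the space of Dirichlet polynomials\<close>

definition dirichlet_kernel :: "(nat \<Rightarrow> real) \<Rightarrow> nat set \<Rightarrow> real \<Rightarrow> complex" where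
  "dirichlet_kernel \<omega> J t = (\<Sum>n\<in>J. cis (- \<omega> n * t))"

lemma trig_poly_dirichlet_kernel:
  assumes "finite J"
  shows "\<exists>m. trig_poly (dirichlet_kernel \<omega> J) m" "\<exists>m. trig_poly (\<lambda>t. cnj (dirichlet_kernel \<omega> J t)) m"
proof -
  have "trig_poly (\<lambda>t. cis (a * t)) (if a = 0 then 1 else 0)" for a
    using trig_poly.monomial[of 1 a] by simp
  from trig_poly_sum[OF assms this, of "\<lambda>n. - \<omega> n"] trig_poly_sum[OF assms this, of \<omega>]
  show "\<exists>m. trig_poly (dirichlet_kernel \<omega> J) m" "\<exists>m. trig_poly (\<lambda>t. cnj (dirichlet_kernel \<omega> J t)) m"
    unfolding dirichlet_kernel_def by (auto simp: cis_cnj)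
qed

lemma dirichlet_kernel_norm_le: "cmod (dirichlet_kernel \<omega> J t) \<le> real (card J)"
  unfolding dirichlet_kernel_def using sum_norm_bound[of J "\<lambda>n. cis (- \<omega> n * t)" 1] by simp

lemma trig_poly_dirichlet_kernel_polynomial:
  assumes "finite J" "real_polynomial_function q"
  shows "\<exists>m. trig_poly (\<lambda>t. of_real (q ((cmod (dirichlet_kernel \<omega> J t))\<^sup>2))) m"
proof -
  obtain m where "trig_poly (\<lambda>t. of_real ((cmod (dirichlet_kernel \<omega> J t))\<^sup>2)) m"
    using trig_poly_dirichlet_kernel[OF assms(1), of \<omega>] trig_poly_mult unfolding complex_norm_square by meson
  then show ?thesis by (rule trig_poly_real_polynomial[OF assms(2)])
qed

text \<open>
  \<open>|D|\<close> is the square root of the trigonometric polynomial \<open>D cnj D\<close>, hence almost periodic by the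
  Weierstrass theorem.  This yields the limit in the theorem.
\<close>

lemma dirichlet_kernel_mean:
  assumes J: "finite J"
  shows "\<exists>L. ap_mean (\<lambda>t. of_real (cmod (dirichlet_kernel \<omega> J t))) (of_real L) \<and>
             ((\<lambda>T. 1 / (2 * T) * integral {-T..T} (\<lambda>t. cmod (dirichlet_kernel \<omega> J t))) \<longlongrightarrow> L) at_top"
proof -
  let ?f = "\<lambda>t. cmod (dirichlet_kernel \<omega> J t)"
  have "\<exists>L. ap_mean (\<lambda>t. of_real (?f t)) L"
  proof (rule ap_mean_exists)
    fix \<epsilon> :: real assume "\<epsilon> > 0"
    then obtain q where q: "real_polynomial_function q"
      "\<And>y. 0 \<le> y \<Longrightarrow> y \<le> real (card J) \<Longrightarrow> \<bar>y\<^sup>2 * q (y\<^sup>2) - y\<bar> \<le> \<epsilon>"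
      using polynomial_sign_approximation by metis
    have "real_polynomial_function (\<lambda>x::real. x * q x)"
      by (rule real_polynomial_function.intros(4)[OF real_polynomial_function.intros(1)[OF bounded_linear_ident] q(1)])
    then obtain m where "trig_poly (\<lambda>t. of_real ((?f t)\<^sup>2 * q ((?f t)\<^sup>2))) m"
      using trig_poly_dirichlet_kernel_polynomial[OF J] by blast
    moreover have "cmod (of_real (?f t) - of_real ((?f t)\<^sup>2 * q ((?f t)\<^sup>2))) \<le> \<epsilon>" for t
      using q(2)[of "?f t"] dirichlet_kernel_norm_le[of \<omega> J t]
      by (simp only: of_real_diff[symmetric] norm_of_real abs_minus_commute norm_ge_zero)
    ultimately show "\<exists>g m. trig_poly g m \<and> (\<forall>t. cmod (of_real (?f t) - g t) \<le> \<epsilon>)" by blast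
  qed
  then obtain L where L: "ap_mean (\<lambda>t. of_real (?f t)) L" by blast
  have cont: "continuous_on A (dirichlet_kernel \<omega> J)" for A
    unfolding dirichlet_kernel_def by (auto intro!: continuous_intros)
  then have "continuous_on UNIV (\<lambda>t. complex_of_real (?f t))"
    by (intro continuous_intros)
  from ap_mean_integral[OF L this]
  have lim: "((\<lambda>T. integral {-T..T} (\<lambda>t. complex_of_real (?f t)) / of_real (2 * T)) \<longlongrightarrow> L) at_top" .
  have "?f integrable_on {-T..T}" for T
    by (intro integrable_continuous_interval continuous_intros cont)
  then have int: "integral {-T..T} (\<lambda>t. complex_of_real (?f t)) = of_real (integral {-T..T} ?f)" for T
    using has_integral_of_real integrable_integral integral_unique by blast
  have lim': "((\<lambda>T. of_real (1 / (2 * T) * integral {-T..T} ?f)) \<longlongrightarrow> L) at_top"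
    using lim unfolding int by simp
  have "Im L = 0"
    using tendsto_unique[OF _ tendsto_Im[OF lim'], of 0] by simp
  then have "L = of_real (Re L)" by (simp add: complex_eq_iff)
  then have "ap_mean (\<lambda>t. of_real (?f t)) (of_real (Re L))" using L by metis
  moreover have "((\<lambda>T. 1 / (2 * T) * integral {-T..T} ?f) \<longlongrightarrow> Re L) at_top"
    using tendsto_Re[OF lim'] by simp
  ultimately show ?thesis by blast
qed

lemma dirichlet_polynomial_imaginary_axis:
  "dirichlet_polynomial \<omega> J a (\<i> * of_real t) = (\<Sum>n\<in>J. a n * cis (- \<omega> n * t))"
  unfolding dirichlet_polynomial_def cis_conv_exp by (simp add: mult_ac)

lemma dirichlet_polynomial_add:
  "dirichlet_polynomial \<omega> J (\<lambda>n. a n + b n) =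
   (\<lambda>s. dirichlet_polynomial \<omega> J a s + dirichlet_polynomial \<omega> J b s)"
  unfolding dirichlet_polynomial_def by (simp add: distrib_right sum.distrib)

lemma dirichlet_polynomial_cmult:
  "dirichlet_polynomial \<omega> J (\<lambda>n. c * a n) = (\<lambda>s. c * dirichlet_polynomial \<omega> J a s)"
  unfolding dirichlet_polynomial_def by (simp add: sum_distrib_left mult.assoc)

text \<open>
  The \<open>n\<close>-th coefficient is the mean of \<open>t \<mapsto> D(\<i>t) e\<^bsup>\<i>\<omega>\<^sub>nt\<^esup>\<close>.  Hence the coefficients are linear
  functionals of norm at most 1.
\<close>

lemma dirichlet_coefficient_le:
  assumes J: "finite J" "inj_on \<omega> J" "n \<in> J"
    and B: "\<And>t. cmod (dirichlet_polynomial \<omega> J a (\<i> * of_real t)) \<le> B"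
  shows "cmod (a n) \<le> B"
proof -
  have "trig_poly (\<lambda>t. \<Sum>m\<in>J. a m * cis ((\<omega> n - \<omega> m) * t)) (\<Sum>m\<in>J. if \<omega> n - \<omega> m = 0 then a m else 0)"
    using trig_poly_sum[OF J(1) trig_poly.monomial, of a "\<lambda>m. \<omega> n - \<omega> m"] .
  moreover have "(\<Sum>m\<in>J. if \<omega> n - \<omega> m = 0 then a m else 0) = (\<Sum>m\<in>J. if m = n then a m else 0)"
    using J by (intro sum.cong) (auto simp: inj_on_def)
  ultimately have "trig_poly (\<lambda>t. \<Sum>m\<in>J. a m * cis ((\<omega> n - \<omega> m) * t)) (a n)"
    using J by simp
  moreover have "cmod (\<Sum>m\<in>J. a m * cis ((\<omega> n - \<omega> m) * t)) \<le> B" for t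
  proof -
    have "cis (\<omega> n * t) * cis (- \<omega> m * t) = cis ((\<omega> n - \<omega> m) * t)" for m
      unfolding cis_mult by (rule arg_cong[where f = cis]) (simp add: algebra_simps)
    then have "(\<Sum>m\<in>J. a m * cis ((\<omega> n - \<omega> m) * t)) =
          cis (\<omega> n * t) * dirichlet_polynomial \<omega> J a (\<i> * of_real t)"
      unfolding dirichlet_polynomial_imaginary_axis sum_distrib_left
      by (intro sum.cong refl) (metis mult.left_commute)
    then show ?thesis using B[of t] by (simp add: norm_mult)
  qed
  ultimately show ?thesis by (rule trig_poly_mean_le)
qed

lemma dirichlet_space_simps [simp]:
  "carrier (dirichlet_space \<omega> J) = range (dirichlet_polynomial \<omega> J)"
  "add (dirichlet_space \<omega> J) = (\<lambda>D E s. D s + E s)"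
  "smult (dirichlet_space \<omega> J) = (\<lambda>c D s. c * D s)"
  by (simp_all add: dirichlet_space_def)

lemma dirichlet_space_norm_bounds:
  shows "cmod (dirichlet_polynomial \<omega> J a (\<i> * of_real t)) \<le> nrm (dirichlet_space \<omega> J) (dirichlet_polynomial \<omega> J a)"
    and "(\<And>t. cmod (dirichlet_polynomial \<omega> J a (\<i> * of_real t)) \<le> B) \<Longrightarrow>
         nrm (dirichlet_space \<omega> J) (dirichlet_polynomial \<omega> J a) \<le> B"
proof -
  have "cmod (dirichlet_polynomial \<omega> J a (\<i> * of_real t)) \<le> (\<Sum>n\<in>J. cmod (a n))" for t
    unfolding dirichlet_polynomial_imaginary_axis
    by (rule order.trans[OF norm_sum]) (simp add: norm_mult)
  then have "bdd_above (range (\<lambda>t. cmod (dirichlet_polynomial \<omega> J a (\<i> * of_real t))))"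
    by (intro bdd_aboveI2)
  then show "cmod (dirichlet_polynomial \<omega> J a (\<i> * of_real t)) \<le> nrm (dirichlet_space \<omega> J) (dirichlet_polynomial \<omega> J a)"
    unfolding dirichlet_space_def cnormed.simps by (rule cSUP_upper[OF UNIV_I])
  show "(\<And>t. cmod (dirichlet_polynomial \<omega> J a (\<i> * of_real t)) \<le> B) \<Longrightarrow>
         nrm (dirichlet_space \<omega> J) (dirichlet_polynomial \<omega> J a) \<le> B"
    by (simp add: dirichlet_space_def cSUP_least)
qed

section \<open>The upper estimate\<close>

sublocale complex_banach \<subseteq> complex_vector_space Y
  by unfold_locales

context complex_vector_space
begin

lemma linear_functional_add:
  "linear_functional f \<Longrightarrow> linear_functional g \<Longrightarrow> linear_functional (\<lambda>y. f y + g y)"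
  unfolding linear_functional_def by (simp add: distrib_left)

lemma linear_functional_diff:
  "linear_functional f \<Longrightarrow> linear_functional g \<Longrightarrow> linear_functional (\<lambda>y. f y - g y)"
  unfolding linear_functional_def by (simp add: right_diff_distrib)

lemma linear_functional_mult_right:
  "linear_functional f \<Longrightarrow> linear_functional (\<lambda>y. f y * c)"
  unfolding linear_functional_def by (simp add: distrib_right mult.assoc)

lemma linear_functional_sum:
  "(\<And>i. i \<in> A \<Longrightarrow> linear_functional (f i)) \<Longrightarrow> linear_functional (\<lambda>y. \<Sum>i\<in>A. f i y)"
  unfolding linear_functional_def by (simp add: sum.distrib sum_distrib_left)

end

lemma op_norm_le:
  assumes "\<And>x. x \<in> carrier X \<Longrightarrow> nrm Y (f x) \<le> C * nrm X x" "0 \<le> C"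
  shows "op_norm X Y f \<le> ennreal C"
  unfolding op_norm_def
proof (rule SUP_least)
  fix x assume "x \<in> {x \<in> carrier X. nrm X x \<le> 1}"
  then have x: "x \<in> carrier X" "nrm X x \<le> 1" by auto
  have "nrm Y (f x) \<le> C * 1"
    using assms(1)[OF x(1)] mult_left_mono[OF x(2) assms(2)] by linarith
  then show "ennreal (nrm Y (f x)) \<le> ennreal C" by (simp add: ennreal_leI)
qed

locale dirichlet_embedding = complex_banach Y for Y :: "'b cnormed" (structure) +
  fixes \<omega> :: "nat \<Rightarrow> real" and J :: "nat set" and I :: "(complex \<Rightarrow> complex) \<Rightarrow> 'b"
  assumes finite_J: "finite J" and inj_\<omega>: "inj_on \<omega> J"
    and iso: "isometric_embedding (dirichlet_space \<omega> J) Y I"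
begin

abbreviation X where "X \<equiv> dirichlet_space \<omega> J"
abbreviation dp where "dp \<equiv> dirichlet_polynomial \<omega> J"

lemma I_in: "I (dp a) \<in> carrier Y"
  using iso by (auto simp: isometric_embedding_def linear_between_def)

lemma I_add: "I (\<lambda>s. dp a s + dp b s) = I (dp a) \<oplus> I (dp b)"
  using iso by (simp add: isometric_embedding_def linear_between_def)

lemma I_cmult: "I (\<lambda>s. c * dp a s) = c \<odot> I (dp a)"
  using iso by (simp add: isometric_embedding_def linear_between_def)

lemma nrm_I: "nrm Y (I (dp a)) = nrm X (dp a)"
  using iso by (simp add: isometric_embedding_def)

text \<open>
  Functionals on the space of Dirichlet polynomials are given here on coefficient sequences.  They
  are well defined on functions since they are dominated by the norm: two sequences that represent
  the same vector of \<open>Y\<close> differ by a sequence which represents 0.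
\<close>

lemma norm_preserving_extension:
  assumes add: "\<And>a b. \<psi> (\<lambda>n. a n + b n) = \<psi> a + \<psi> b"
    and cmult: "\<And>c a. \<psi> (\<lambda>n. c * a n) = c * \<psi> a"
    and bound: "\<And>a. cmod (\<psi> a) \<le> nrm X (dp a)"
  shows "\<exists>F. linear_functional F \<and> (\<forall>y\<in>carrier Y. cmod (F y) \<le> nrm Y y) \<and> (\<forall>a. F (I (dp a)) = \<psi> a)"
proof -
  define f where "f y = \<psi> (SOME a. I (dp a) = y)" for y
  have f: "f (I (dp a)) = \<psi> a" for a
  proof -
    define b where "b = (SOME b. I (dp b) = I (dp a))"
    have b: "I (dp b) = I (dp a)" unfolding b_def by (rule someI[of _ a]) simp
    have "I (dp (\<lambda>n. a n + (-1) * b n)) = I (dp a) \<oplus> I (dp (\<lambda>n. (-1) * b n))"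
      unfolding dirichlet_polynomial_add by (rule I_add)
    also have "I (dp (\<lambda>n. (-1) * b n)) = (-1) \<odot> I (dp a)"
      unfolding dirichlet_polynomial_cmult I_cmult b ..
    also have "I (dp a) \<oplus> (-1) \<odot> I (dp a) = \<zero>"
      using smult_distribs(1)[OF I_in, of 1 "-1" a] smult_distribs(3,4)[OF I_in, of a] by simp
    finally have "nrm X (dp (\<lambda>n. a n + (-1) * b n)) = 0"
      by (metis nrm_I nrm_eq_zero_iff zero_closed)
    then have "\<psi> (\<lambda>n. a n + (-1) * b n) = 0"
      using bound by (metis norm_le_zero_iff)
    then have "\<psi> a = \<psi> b" unfolding add cmult by simp
    then show ?thesis by (simp add: f_def b_def)
  qed
  have "\<exists>F. linear_functional F \<and> (\<forall>x\<in>carrier Y. cmod (F x) \<le> nrm Y x) \<and>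
            (\<forall>x\<in>range (\<lambda>a. I (dp a)). F x = f x)"
  proof (rule complex_hahn_banach)
    show "range (\<lambda>a. I (dp a)) \<subseteq> carrier Y" using I_in by auto
    fix x y assume "x \<in> range (\<lambda>a. I (dp a))" "y \<in> range (\<lambda>a. I (dp a))"
    then obtain a b where "x = I (dp a)" "y = I (dp b)" by auto
    then have eq: "x \<oplus> y = I (dp (\<lambda>n. a n + b n))" by (simp only: dirichlet_polynomial_add I_add)
    then show "x \<oplus> y \<in> range (\<lambda>a. I (dp a))" by blast
    show "f (x \<oplus> y) = f x + f y" unfolding eq using \<open>x = _\<close> \<open>y = _\<close> by (simp only: f add)
  next
    fix c x assume "x \<in> range (\<lambda>a. I (dp a))"
    then obtain a where "x = I (dp a)" by auto
    then have eq: "c \<odot> x = I (dp (\<lambda>n. c * a n))" by (simp only: dirichlet_polynomial_cmult I_cmult)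
    then show "c \<odot> x \<in> range (\<lambda>a. I (dp a))" by blast
    show "f (c \<odot> x) = c * f x" unfolding eq using \<open>x = _\<close> by (simp only: f cmult)
  next
    fix x assume "x \<in> range (\<lambda>a. I (dp a))"
    then show "cmod (f x) \<le> nrm Y x" using bound by (auto simp: f nrm_I)
  qed (auto simp: nrm_triangle nrm_smult)
  then show ?thesis using f by auto
qed

text \<open>
  Every projection onto the image of \<open>I\<close> is described by its coordinate functionals; the estimate of
  the norm is then one over the imaginary axis.
\<close>

lemma coefficient_projection:
  assumes lin: "\<And>n. n \<in> J \<Longrightarrow> linear_functional (p n)"
    and id: "\<And>n a. n \<in> J \<Longrightarrow> p n (I (dp a)) = a n"
    and bound: "\<And>y t. y \<in> carrier Y \<Longrightarrow> cmod (\<Sum>n\<in>J. p n y * cis (- \<omega> n * t)) \<le> C * nrm Y y"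
    and "0 \<le> C"
  shows "\<exists>P\<in>projections (I ` carrier X) Y. op_norm Y Y P \<le> ennreal C"
proof (intro bexI)
  let ?P = "\<lambda>y. I (dp (\<lambda>n. p n y))"
  have dp_cong: "dp a = dp b" if "\<And>n. n \<in> J \<Longrightarrow> a n = b n" for a b
    unfolding dirichlet_polynomial_def using that by simp
  have "nrm Y (?P y) \<le> C * nrm Y y" if "y \<in> carrier Y" for y
    unfolding nrm_I using bound[OF that]
    by (intro dirichlet_space_norm_bounds(2)) (simp only: dirichlet_polynomial_imaginary_axis)
  then show le: "op_norm Y Y ?P \<le> ennreal C" using \<open>0 \<le> C\<close> by (intro op_norm_le) auto
  have "?P (x \<oplus> y) = ?P x \<oplus> ?P y" if "x \<in> carrier Y" "y \<in> carrier Y" for x y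
  proof -
    have "dp (\<lambda>n. p n (x \<oplus> y)) = dp (\<lambda>n. p n x + p n y)"
      using lin that by (intro dp_cong) (auto simp: linear_functional_def)
    then show ?thesis by (simp only: dirichlet_polynomial_add I_add)
  qed
  moreover have "?P (c \<odot> x) = c \<odot> ?P x" if "x \<in> carrier Y" for c x
  proof -
    have "dp (\<lambda>n. p n (c \<odot> x)) = dp (\<lambda>n. c * p n x)"
      using lin that by (intro dp_cong) (auto simp: linear_functional_def)
    then show ?thesis by (simp only: dirichlet_polynomial_cmult I_cmult)
  qed
  moreover have "?P (I (dp a)) = I (dp a)" for a
    using dp_cong[of "\<lambda>n. p n (I (dp a))" a] id by simp
  moreover have "op_norm Y Y ?P < \<infinity>" using le by (simp add: le_less_trans ennreal_less_top)
  ultimately show "?P \<in> projections (I ` carrier X) Y"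
    unfolding projections_def linear_between_def by auto
qed

lemma extended_coefficients:
  "\<exists>r. \<forall>n\<in>J. linear_functional (r n) \<and> (\<forall>y\<in>carrier Y. cmod (r n y) \<le> nrm Y y) \<and>
        (\<forall>a. r n (I (dp a)) = a n)"
proof -
  have "\<exists>F. linear_functional F \<and> (\<forall>y\<in>carrier Y. cmod (F y) \<le> nrm Y y) \<and> (\<forall>a. F (I (dp a)) = a n)"
    if "n \<in> J" for n
    by (rule norm_preserving_extension)
      (auto intro: dirichlet_coefficient_le[OF finite_J inj_\<omega> that] dirichlet_space_norm_bounds(1))
  then show ?thesis by metis
qed

lemma extended_evaluations:
  "\<exists>\<phi>. \<forall>t. linear_functional (\<phi> t) \<and> (\<forall>y\<in>carrier Y. cmod (\<phi> t y) \<le> nrm Y y) \<and>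
        (\<forall>a. \<phi> t (I (dp a)) = dp a (\<i> * of_real t))"
proof -
  have "\<exists>F. linear_functional F \<and> (\<forall>y\<in>carrier Y. cmod (F y) \<le> nrm Y y) \<and>
            (\<forall>a. F (I (dp a)) = dp a (\<i> * of_real t))" for t
    by (rule norm_preserving_extension)
      (auto simp: dirichlet_polynomial_add dirichlet_polynomial_cmult intro: dirichlet_space_norm_bounds(1))
  then show ?thesis by metis
qed

lemma complemented: "projections (I ` carrier X) Y \<noteq> {}"
proof -
  obtain r where r: "\<And>n. n \<in> J \<Longrightarrow> linear_functional (r n)"
      "\<And>n y. n \<in> J \<Longrightarrow> y \<in> carrier Y \<Longrightarrow> cmod (r n y) \<le> nrm Y y"
      "\<And>n a. n \<in> J \<Longrightarrow> r n (I (dp a)) = a n"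
    using extended_coefficients by metis
  have "\<exists>P\<in>projections (I ` carrier X) Y. op_norm Y Y P \<le> ennreal (real (card J))"
  proof (rule coefficient_projection)
    fix y t assume "y \<in> carrier Y"
    then show "cmod (\<Sum>n\<in>J. r n y * cis (- \<omega> n * t)) \<le> real (card J) * nrm Y y"
      using r(2) by (intro sum_norm_bound) (simp add: norm_mult)
  qed (use r in auto)
  then show ?thesis by blast
qed

text \<open>
  Let \<open>\<phi>\<^sub>t\<close> be norm preserving extensions of the evaluations at \<open>\<i>t\<close>.  If \<open>Y\<close> is the space of almost
  periodic functions on the line, the natural projection is the convolution of \<open>y\<close> with the kernel
  \<open>D\<close> with respect to the mean.  For a general \<open>Y\<close> take the sampled version
  \<open>Q y = (1/N) \<Sum>\<^sub>j \<phi>\<^bsub>jh\<^esub>(y) D(\<cdot> - jh)\<close>.  Its norm is at most the largest sampled mean of a translate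
  of \<open>|D|\<close>, hence close to \<open>L\<close>, but it fixes Dirichlet polynomials only up to a small error.  Adding
  \<open>(id - Q) R\<close>, where \<open>R\<close> is the bounded projection given by extended coefficient functionals,
  repairs this exactly: the sum is the identity on the image of \<open>I\<close>, and since \<open>id - Q\<close> is small on
  this image the norm hardly changes.  Norms that come arbitrarily close to \<open>L\<close> are enough, since the
  relative projection constant is an infimum.
\<close>

lemma relative_projection_constant_le:
  assumes L: "ap_mean (\<lambda>t. of_real (cmod (dirichlet_kernel \<omega> J t))) (of_real L)"
  shows "relative_projection_constant (I ` carrier X) Y \<le> ennreal L"
proof (rule ennreal_le_epsilon)
  fix \<epsilon> :: real assume \<epsilon>: "\<epsilon> > 0"
  obtain r where r: "\<And>n. n \<in> J \<Longrightarrow> linear_functional (r n)"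
      "\<And>n y. n \<in> J \<Longrightarrow> y \<in> carrier Y \<Longrightarrow> cmod (r n y) \<le> nrm Y y"
      "\<And>n a. n \<in> J \<Longrightarrow> r n (I (dp a)) = a n"
    using extended_coefficients by metis
  obtain \<phi> where \<phi>: "\<And>t. linear_functional (\<phi> t)"
      "\<And>t y. y \<in> carrier Y \<Longrightarrow> cmod (\<phi> t y) \<le> nrm Y y"
      "\<And>t a. \<phi> t (I (dp a)) = dp a (\<i> * of_real t)"
    using extended_evaluations by metis
  let ?d = "real (card J)"
  (* The sampled mean of the kernel contributes one error \<eta>, and the correction term one for
     each entry of the matrix of id - Q. *)
  define \<eta> where "\<eta> = \<epsilon> / (1 + ?d * ?d)"
  have pos: "1 + ?d * ?d > 0" by (simp add: add_pos_nonneg)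
  have \<eta>: "\<eta> > 0" "\<eta> + ?d * (?d * \<eta>) = \<epsilon>"
  proof -
    show "\<eta> > 0" using \<epsilon> pos by (simp add: \<eta>_def)
    have "\<eta> * (1 + ?d * ?d) = \<epsilon>" unfolding \<eta>_def using pos by simp
    then show "\<eta> + ?d * (?d * \<eta>) = \<epsilon>" by (simp add: algebra_simps)
  qed
  have ev1: "\<forall>\<^sub>F h in at_right 0. \<forall>\<^sub>F N in sequentially. \<forall>s.
      cmod ((\<Sum>j<N. of_real (cmod (dirichlet_kernel \<omega> J (s - real j * h)))) / of_nat N - of_real L) < \<eta>"
    by (rule ap_mean_discrete[OF L \<eta>(1)])
  have ev2: "\<forall>\<^sub>F h in at_right 0. \<forall>mn\<in>J\<times>J. \<forall>\<^sub>F N in sequentially. \<forall>s.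
      cmod ((\<Sum>j<N. cis ((\<omega> (snd mn) - \<omega> (fst mn)) * (s - real j * h))) / of_nat N
        - (if fst mn = snd mn then 1 else 0)) < \<eta>"
  proof (rule eventually_ball_finite, goal_cases)
    case 1
    show ?case using finite_J by simp
  next
    case 2
    show ?case
    proof
      fix mn assume mn: "mn \<in> J \<times> J"
      have "trig_poly (\<lambda>t. cis ((\<omega> (snd mn) - \<omega> (fst mn)) * t)) (if fst mn = snd mn then 1 else 0)"
        using trig_poly.monomial[of 1 "\<omega> (snd mn) - \<omega> (fst mn)"] mn inj_\<omega>
        by (auto simp: inj_on_def split: if_splits)
      then show "\<forall>\<^sub>F h in at_right 0. \<forall>\<^sub>F N in sequentially. \<forall>s.
          cmod ((\<Sum>j<N. cis ((\<omega> (snd mn) - \<omega> (fst mn)) * (s - real j * h))) / of_nat N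
            - (if fst mn = snd mn then 1 else 0)) < \<eta>"
        by (intro ap_mean_discrete[OF trig_poly_imp_ap_mean] \<eta>(1))
    qed
  qed
  obtain h where h: "\<forall>\<^sub>F N in sequentially. \<forall>s.
      cmod ((\<Sum>j<N. of_real (cmod (dirichlet_kernel \<omega> J (s - real j * h)))) / of_nat N - of_real L) < \<eta>"
    "\<forall>mn\<in>J\<times>J. \<forall>\<^sub>F N in sequentially. \<forall>s.
      cmod ((\<Sum>j<N. cis ((\<omega> (snd mn) - \<omega> (fst mn)) * (s - real j * h))) / of_nat N
        - (if fst mn = snd mn then 1 else 0)) < \<eta>"
    using eventually_happens[OF eventually_conj[OF ev1 ev2]] by auto
  have "\<forall>\<^sub>F N in sequentially. \<forall>mn\<in>J\<times>J. \<forall>s.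
      cmod ((\<Sum>j<N. cis ((\<omega> (snd mn) - \<omega> (fst mn)) * (s - real j * h))) / of_nat N
        - (if fst mn = snd mn then 1 else 0)) < \<eta>"
    using finite_J h(2) by (intro eventually_ball_finite) auto
  from eventually_happens[OF eventually_conj[OF eventually_conj[OF h(1) this] eventually_gt_at_top[of 0]]]
  obtain N where N: "N > 0" "\<And>s.
      cmod ((\<Sum>j<N. of_real (cmod (dirichlet_kernel \<omega> J (s - real j * h)))) / of_nat N - of_real L) < \<eta>"
    "\<And>m n s. m \<in> J \<Longrightarrow> n \<in> J \<Longrightarrow>
      cmod ((\<Sum>j<N. cis ((\<omega> n - \<omega> m) * (s - real j * h))) / of_nat N
        - (if m = n then 1 else 0)) < \<eta>"
    by auto
  (* q gives the coordinates of Q, and A the matrix of Q restricted to the Dirichlet polynomials;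
     p gives the coordinates of Q + (id - Q) R. *)
  define q where "q m y = (\<Sum>j<N. \<phi> (real j * h) y * (cis (\<omega> m * (real j * h)) / of_nat N))" for m y
  define A where "A m n = (\<Sum>j<N. cis ((\<omega> m - \<omega> n) * (real j * h))) / of_nat N" for m n
  define p where "p m y = q m y + (r m y - (\<Sum>n\<in>J. r n y * A m n))" for m y
  have A: "cmod ((if m = n then 1 else 0) - A m n) \<le> \<eta>" if "m \<in> J" "n \<in> J" for m n
  proof -
    have "cis ((\<omega> n - \<omega> m) * (0 - real j * h)) = cis ((\<omega> m - \<omega> n) * (real j * h))" for j
      by (rule arg_cong[where f = cis]) (simp add: algebra_simps)
    then have "cmod (A m n - (if m = n then 1 else 0)) < \<eta>"
      using N(3)[OF that, of 0] by (simp only: A_def)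
    then show ?thesis by (simp only: norm_minus_commute less_imp_le)
  qed
  have mean: "(\<Sum>j<N. cmod (dirichlet_kernel \<omega> J (s - real j * h))) / real N < L + \<eta>" for s
  proof -
    have "cmod (of_real ((\<Sum>j<N. cmod (dirichlet_kernel \<omega> J (s - real j * h))) / real N - L)) < \<eta>"
      using N(2)[of s] by simp
    then show ?thesis unfolding norm_of_real by linarith
  qed
  have "0 \<le> (\<Sum>j<N. cmod (dirichlet_kernel \<omega> J (0 - real j * h))) / real N"
    by (intro divide_nonneg_nonneg sum_nonneg) auto
  then have L\<eta>: "0 \<le> L + \<eta>" using mean[of 0] by linarith
  have q_id: "q m (I (dp a)) = (\<Sum>n\<in>J. a n * A m n)" if "m \<in> J" for m a
  proof -
    have cis: "cis (- \<omega> n * t) * cis (\<omega> m * t) = cis ((\<omega> m - \<omega> n) * t)" for n t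
      unfolding cis_mult by (rule arg_cong[where f = cis]) (simp add: algebra_simps)
    have "q m (I (dp a)) = (\<Sum>j<N. \<Sum>n\<in>J. a n * (cis (- \<omega> n * (real j * h)) * cis (\<omega> m * (real j * h))) / of_nat N)"
      unfolding q_def \<phi>(3) dirichlet_polynomial_imaginary_axis sum_distrib_right
      by (intro sum.cong refl) simp
    also have "\<dots> = (\<Sum>n\<in>J. a n * A m n)"
      unfolding cis A_def by (subst sum.swap) (simp add: sum_distrib_left sum_divide_distrib)
    finally show ?thesis .
  qed
  have q_sum: "(\<Sum>m\<in>J. q m y * cis (- \<omega> m * t)) =
      (\<Sum>j<N. \<phi> (real j * h) y * dirichlet_kernel \<omega> J (t - real j * h)) / of_nat N" for y t
  proof -
    have cis: "cis (\<omega> m * s) * cis (- \<omega> m * t) = cis (- \<omega> m * (t - s))" for m s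
      unfolding cis_mult by (rule arg_cong[where f = cis]) (simp add: algebra_simps)
    have "(\<Sum>m\<in>J. q m y * cis (- \<omega> m * t)) =
        (\<Sum>m\<in>J. \<Sum>j<N. \<phi> (real j * h) y * (cis (\<omega> m * (real j * h)) * cis (- \<omega> m * t)) / of_nat N)"
      unfolding q_def sum_distrib_right by (intro sum.cong refl) simp
    also have "\<dots> = (\<Sum>j<N. \<phi> (real j * h) y * dirichlet_kernel \<omega> J (t - real j * h)) / of_nat N"
      unfolding cis dirichlet_kernel_def by (subst sum.swap) (simp add: sum_distrib_left sum_divide_distrib)
    finally show ?thesis .
  qed
  have "\<exists>P\<in>projections (I ` carrier X) Y. op_norm Y Y P \<le> ennreal (L + \<epsilon>)"
  proof (rule coefficient_projection)
    show "linear_functional (p m)" if "m \<in> J" for m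
      unfolding p_def q_def using that
      by (intro linear_functional_add linear_functional_diff linear_functional_sum
          linear_functional_mult_right r(1) \<phi>(1))
    show "p m (I (dp a)) = a m" if "m \<in> J" for m a
      unfolding p_def using q_id[OF that] r(3) that by simp
    show "0 \<le> L + \<epsilon>" using L\<eta> \<eta> by (smt (verit) mult_nonneg_nonneg of_nat_0_le_iff)
    fix y t assume y: "y \<in> carrier Y"
    have ny: "0 \<le> nrm Y y" using y by (rule nrm_nonneg)
    have "cmod (\<Sum>j<N. \<phi> (real j * h) y * dirichlet_kernel \<omega> J (t - real j * h))
        \<le> (\<Sum>j<N. nrm Y y * cmod (dirichlet_kernel \<omega> J (t - real j * h)))"
      using \<phi>(2)[OF y] by (intro sum_norm_le) (simp add: norm_mult mult_right_mono)
    then have "cmod (\<Sum>m\<in>J. q m y * cis (- \<omega> m * t))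
        \<le> nrm Y y * ((\<Sum>j<N. cmod (dirichlet_kernel \<omega> J (t - real j * h))) / real N)"
      unfolding q_sum using N(1) by (simp add: norm_divide sum_distrib_left divide_right_mono)
    also have "\<dots> \<le> nrm Y y * (L + \<eta>)"
      using mean[of t] ny by (intro mult_left_mono) auto
    finally have 1: "cmod (\<Sum>m\<in>J. q m y * cis (- \<omega> m * t)) \<le> nrm Y y * (L + \<eta>)" .
    have corr: "cmod (r m y - (\<Sum>n\<in>J. r n y * A m n)) \<le> ?d * (nrm Y y * \<eta>)" if m: "m \<in> J" for m
    proof -
      have "r m y - (\<Sum>n\<in>J. r n y * A m n) = (\<Sum>n\<in>J. r n y * ((if m = n then 1 else 0) - A m n))"
        using m finite_J by (simp add: right_diff_distrib sum_subtractf if_distrib[of "\<lambda>c. _ * c"] cong: if_cong)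
      also have "cmod \<dots> \<le> ?d * (nrm Y y * \<eta>)"
        using r(2) y A[OF m] ny by (intro sum_norm_bound) (simp add: norm_mult mult_mono)
      finally show ?thesis .
    qed
    have 2: "cmod (\<Sum>m\<in>J. (r m y - (\<Sum>n\<in>J. r n y * A m n)) * cis (- \<omega> m * t)) \<le> ?d * (?d * (nrm Y y * \<eta>))"
      using corr by (intro sum_norm_bound) (simp add: norm_mult)
    have "(\<Sum>m\<in>J. p m y * cis (- \<omega> m * t)) = (\<Sum>m\<in>J. q m y * cis (- \<omega> m * t)) +
        (\<Sum>m\<in>J. (r m y - (\<Sum>n\<in>J. r n y * A m n)) * cis (- \<omega> m * t))"
      unfolding p_def by (simp add: distrib_right sum.distrib)
    then have "cmod (\<Sum>m\<in>J. p m y * cis (- \<omega> m * t)) \<le> nrm Y y * (L + \<eta>) + ?d * (?d * (nrm Y y * \<eta>))"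
      using norm_triangle_mono[OF 1 2] by simp
    also have "\<dots> = (L + (\<eta> + ?d * (?d * \<eta>))) * nrm Y y" by (simp add: algebra_simps)
    finally show "cmod (\<Sum>m\<in>J. p m y * cis (- \<omega> m * t)) \<le> (L + \<epsilon>) * nrm Y y" unfolding \<eta>(2) .
  qed
  then obtain P where P: "P \<in> projections (I ` carrier X) Y" "op_norm Y Y P \<le> ennreal (L + \<epsilon>)"
    by blast
  have "relative_projection_constant (I ` carrier X) Y \<le> op_norm Y Y P"
    unfolding relative_projection_constant_def by (rule INF_lower[OF P(1)])
  also have "\<dots> \<le> ennreal L + ennreal \<epsilon>"
    using \<epsilon> by (intro order.trans[OF P(2)]) (auto simp: ennreal_plus_if intro: ennreal_leI)
  finally show "relative_projection_constant (I ` carrier X) Y \<le> ennreal L + ennreal \<epsilon>" .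
qed

end

section \<open>The lower estimate\<close>

lemma trig_poly_bounded:
  assumes "trig_poly f m"
  shows "bounded (range (\<lambda>t. f (t - s)))"
  using assms
proof induction
  case (monomial c \<nu>)
  show ?case by (rule boundedI[of _ "cmod c"]) (auto simp: norm_mult)
next
  case (add f m g k)
  then show ?case using bounded_plus_comp[of "\<lambda>t. f (t - s)" UNIV "\<lambda>t. g (t - s)"] by simp
qed

text \<open>
  Averaging over translations in the manner of Rudin.  For a trigonometric polynomial \<open>g\<close> consider
  \<open>s \<mapsto> (T g\<^sub>s)(s)\<close> with the translates \<open>g\<^sub>s(t) = g(t - s)\<close>.  A monomial of frequency \<open>\<nu>\<close> contributes
  the frequencies \<open>- \<nu> - \<omega>\<^sub>n\<close>, so the mean sees \<open>T\<close> only at the monomials that it fixes, and equals the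
  mean of \<open>g cnj D\<close> whatever \<open>T\<close> is.  If \<open>|g| \<le> 1\<close> this mean is at most \<open>C\<close> in modulus, and
  taking \<open>g\<close> close to the sign of \<open>D\<close> brings it close to the mean \<open>L\<close> of \<open>|D|\<close>.
\<close>

lemma averaging_lower_bound:
  fixes T :: "(real \<Rightarrow> complex) \<Rightarrow> real \<Rightarrow> complex"
  assumes J: "finite J" "inj_on \<omega> J"
    and add: "\<And>f g. bounded (range f) \<Longrightarrow> bounded (range g) \<Longrightarrow> T (\<lambda>t. f t + g t) = (\<lambda>t. T f t + T g t)"
    and cmult: "\<And>c f. bounded (range f) \<Longrightarrow> T (\<lambda>t. c * f t) = (\<lambda>t. c * T f t)"
    and range: "\<And>f. bounded (range f) \<Longrightarrow> \<exists>a. T f = (\<lambda>t. \<Sum>n\<in>J. a n * cis (- \<omega> n * t))"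
    and fixed: "\<And>n. n \<in> J \<Longrightarrow> T (\<lambda>t. cis (- \<omega> n * t)) = (\<lambda>t. cis (- \<omega> n * t))"
    and bound: "\<And>f t. (\<And>s. cmod (f s) \<le> 1) \<Longrightarrow> cmod (T f t) \<le> C"
    and L: "ap_mean (\<lambda>t. of_real (cmod (dirichlet_kernel \<omega> J t))) (of_real L)"
  shows "L \<le> C"
proof -
  let ?D = "dirichlet_kernel \<omega> J"
  have avg: "\<exists>m. trig_poly (\<lambda>s. T (\<lambda>t. g (t - s)) s) m \<and> trig_poly (\<lambda>s. g s * cnj (?D s)) m"
    if "trig_poly g k" for g k
    using that
  proof induction
    case (monomial c \<nu>)
    have bd: "bounded (Set.range (\<lambda>t. cis (\<nu> * t)))" by (rule boundedI[of _ 1]) auto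
    obtain a where a: "T (\<lambda>t. cis (\<nu> * t)) = (\<lambda>t. \<Sum>n\<in>J. a n * cis (- \<omega> n * t))"
      "\<And>n. n \<in> J \<Longrightarrow> \<nu> + \<omega> n = 0 \<Longrightarrow> a n = 1"
    proof (cases "\<exists>k\<in>J. \<nu> = - \<omega> k")
      case True
      then obtain k where k: "k \<in> J" "\<nu> = - \<omega> k" by blast
      have "T (\<lambda>t. cis (\<nu> * t)) = (\<lambda>t. \<Sum>n\<in>J. (if n = k then 1 else 0) * cis (- \<omega> n * t))"
        using fixed[OF k(1)] k J(1) by (simp add: if_distrib[of "\<lambda>c. c * _"] cong: if_cong)
      moreover have "(if n = k then 1 else 0) = (1::complex)" if "n \<in> J" "\<nu> + \<omega> n = 0" for n
        using that k J(2) by (auto simp: inj_on_def)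
      ultimately show ?thesis by (rule that[of "\<lambda>n. if n = k then 1 else 0"])
    next
      case False
      obtain a where "T (\<lambda>t. cis (\<nu> * t)) = (\<lambda>t. \<Sum>n\<in>J. a n * cis (- \<omega> n * t))"
        using range[OF bd] by blast
      moreover have "a n = 1" if "n \<in> J" "\<nu> + \<omega> n = 0" for n
        using that False by (metis add_eq_0_iff2)
      ultimately show ?thesis by (rule that[of a])
    qed
    have shift: "T (\<lambda>t. c * cis (\<nu> * (t - s))) s = (\<Sum>n\<in>J. (c * a n) * cis ((- \<nu> - \<omega> n) * s))" for s
    proof -
      have "cis (\<nu> * (t - s)) = cis (- \<nu> * s) * cis (\<nu> * t)" for t
        unfolding cis_mult by (rule arg_cong[where f = cis]) (simp add: algebra_simps)
      then have "(\<lambda>t. c * cis (\<nu> * (t - s))) = (\<lambda>t. (c * cis (- \<nu> * s)) * cis (\<nu> * t))"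
        by (simp only: mult.assoc)
      then have "T (\<lambda>t. c * cis (\<nu> * (t - s))) s =
          (c * cis (- \<nu> * s)) * (\<Sum>n\<in>J. a n * cis (- \<omega> n * s))"
        by (simp only: cmult[OF bd] a(1))
      also have "\<dots> = (\<Sum>n\<in>J. (c * a n) * (cis (- \<nu> * s) * cis (- \<omega> n * s)))"
        unfolding sum_distrib_left by (intro sum.cong refl) (simp only: mult_ac)
      also have "\<dots> = (\<Sum>n\<in>J. (c * a n) * cis ((- \<nu> - \<omega> n) * s))"
        unfolding cis_mult
        by (intro sum.cong refl arg_cong2[where f = times] arg_cong[where f = cis]) (simp add: algebra_simps)
      finally show ?thesis .
    qed
    have prod: "c * cis (\<nu> * s) * cnj (?D s) = (\<Sum>n\<in>J. c * cis ((\<nu> + \<omega> n) * s))" for s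
    proof -
      have "cnj (cis (- \<omega> n * s)) = cis (\<omega> n * s)" for n by (simp add: cis_cnj)
      then have "c * cis (\<nu> * s) * cnj (?D s) = (\<Sum>n\<in>J. c * (cis (\<nu> * s) * cis (\<omega> n * s)))"
        unfolding dirichlet_kernel_def cnj_sum sum_distrib_left by (simp only: mult.assoc)
      also have "\<dots> = (\<Sum>n\<in>J. c * cis ((\<nu> + \<omega> n) * s))"
        unfolding cis_mult by (simp only: distrib_right)
      finally show ?thesis .
    qed
    have "(\<Sum>n\<in>J. if - \<nu> - \<omega> n = 0 then c * a n else 0) = (\<Sum>n\<in>J. if \<nu> + \<omega> n = 0 then c else 0)"
    proof (rule sum.cong)
      fix n assume n: "n \<in> J"
      have "- \<nu> - \<omega> n = 0 \<longleftrightarrow> \<nu> + \<omega> n = 0" by linarith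
      then show "(if - \<nu> - \<omega> n = 0 then c * a n else 0) = (if \<nu> + \<omega> n = 0 then c else 0)"
        using a(2)[OF n] by simp
    qed simp
    moreover have "trig_poly (\<lambda>s. \<Sum>n\<in>J. (c * a n) * cis ((- \<nu> - \<omega> n) * s))
        (\<Sum>n\<in>J. if - \<nu> - \<omega> n = 0 then c * a n else 0)"
      by (rule trig_poly_sum[OF J(1) trig_poly.monomial])
    moreover have "trig_poly (\<lambda>s. \<Sum>n\<in>J. c * cis ((\<nu> + \<omega> n) * s))
        (\<Sum>n\<in>J. if \<nu> + \<omega> n = 0 then c else 0)"
      by (rule trig_poly_sum[OF J(1) trig_poly.monomial])
    ultimately show ?case unfolding shift prod by (intro exI conjI) (simp_all only:)
  next
    case (add f m g k)
    have "T (\<lambda>t. f (t - s) + g (t - s)) s = T (\<lambda>t. f (t - s)) s + T (\<lambda>t. g (t - s)) s" for s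
      using assms(3)[OF trig_poly_bounded[OF add.hyps(1)] trig_poly_bounded[OF add.hyps(2)]]
      by simp
    then show ?case using add.IH by (auto simp: distrib_right intro: trig_poly.add)
  qed
  show ?thesis
  proof (rule field_le_epsilon)
    fix \<epsilon> :: real assume "\<epsilon> > 0"
    then obtain q where q: "real_polynomial_function q"
      "\<And>y. 0 \<le> y \<Longrightarrow> y \<le> real (card J) \<Longrightarrow> \<bar>y\<^sup>2 * q (y\<^sup>2) - y\<bar> \<le> \<epsilon>"
      "\<And>y. 0 \<le> y \<Longrightarrow> y \<le> real (card J) \<Longrightarrow> \<bar>y * q (y\<^sup>2)\<bar> \<le> 1"
      using polynomial_sign_approximation[of \<epsilon> "real (card J)"] by auto
    define g where "g t = ?D t * of_real (q ((cmod (?D t))\<^sup>2))" for t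
    obtain k where "trig_poly g k"
      using trig_poly_dirichlet_kernel(1)[OF J(1)] trig_poly_dirichlet_kernel_polynomial[OF J(1) q(1)] trig_poly_mult
      unfolding g_def by meson
    then obtain m where m: "trig_poly (\<lambda>s. T (\<lambda>t. g (t - s)) s) m" "trig_poly (\<lambda>s. g s * cnj (?D s)) m"
      using avg by blast
    have "cmod (g t) \<le> 1" for t
      using q(3)[of "cmod (?D t)"] dirichlet_kernel_norm_le[of \<omega> J t] by (simp add: g_def norm_mult abs_mult)
    then have 1: "cmod m \<le> C"
      by (intro trig_poly_mean_le[OF m(1)] bound)
    have "cmod (m - of_real L) \<le> \<epsilon>"
    proof (rule trig_poly_mean_close[OF m(2) L])
      fix t
      have "g t * cnj (?D t) = (?D t * cnj (?D t)) * of_real (q ((cmod (?D t))\<^sup>2))"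
        by (simp add: g_def)
      also have "\<dots> = of_real ((cmod (?D t))\<^sup>2 * q ((cmod (?D t))\<^sup>2))"
        by (simp only: complex_norm_square[symmetric] of_real_mult)
      finally show "cmod (g t * cnj (?D t) - of_real (cmod (?D t))) \<le> \<epsilon>"
        using q(2)[of "cmod (?D t)"] dirichlet_kernel_norm_le[of \<omega> J t]
        by (simp only: of_real_diff[symmetric] norm_of_real norm_ge_zero)
    qed
    then have "\<bar>L\<bar> \<le> cmod m + \<epsilon>"
      using norm_triangle_ineq2[of "of_real L" m] by (simp add: norm_minus_commute)
    then show "L \<le> C + \<epsilon>" using 1 by linarith
  qed
qed

text \<open>
  The space of all bounded functions with the supremum norm, in the right summand of the type in
  which the projection constant looks for its spaces.
\<close>

definition bounded_function_space :: "('u + ('a \<Rightarrow> complex)) cnormed" where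
  "bounded_function_space =
     \<lparr>carrier = Inr ` {F. bounded (range F)},
      mult = undefined,
      one = undefined,
      zero = Inr (\<lambda>g. 0),
      add = (\<lambda>x y. Inr (\<lambda>g. projr x g + projr y g)),
      smult = (\<lambda>c x. Inr (\<lambda>g. c * projr x g)),
      nrm = (\<lambda>x. SUP g. cmod (projr x g))\<rparr>"

lemma bounded_function_space_simps [simp]:
  "carrier bounded_function_space = Inr ` {F. bounded (range F)}"
  "zero bounded_function_space = Inr (\<lambda>g. 0)"
  "add bounded_function_space = (\<lambda>x y. Inr (\<lambda>g. projr x g + projr y g))"
  "smult bounded_function_space = (\<lambda>c x. Inr (\<lambda>g. c * projr x g))"
  by (simp_all add: bounded_function_space_def)

lemma bounded_function_space_norm_upper:
  assumes "bounded (range F)"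
  shows "cmod (F g) \<le> nrm bounded_function_space (Inr F)"
proof -
  have "bdd_above (range (\<lambda>g. cmod (F g)))"
    using assms by (auto simp: bounded_iff intro: bdd_aboveI2)
  then show ?thesis unfolding bounded_function_space_def cnormed.simps sum.sel
    by (rule cSUP_upper[OF UNIV_I])
qed

lemma bounded_function_space_norm_least:
  assumes "\<And>g. cmod (F g) \<le> B"
  shows "nrm bounded_function_space (Inr F) \<le> B"
  unfolding bounded_function_space_def cnormed.simps sum.sel
  using assms by (intro cSUP_least) auto

lemma cring_complex_field: "cring complex_field"
proof (rule cringI)
  show "abelian_group complex_field"
    by (rule abelian_groupI) (auto simp: add.assoc add.commute intro: exI[of _ "- _"])
  show "comm_monoid complex_field"
    by (rule comm_monoidI) (auto simp: mult.assoc mult.commute)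
qed (auto simp: distrib_right)

lemma bounded_cmult:
  fixes F :: "'a \<Rightarrow> complex"
  assumes "bounded (range F)"
  shows "bounded (range (\<lambda>g. c * F g))"
proof -
  obtain B where "\<And>g. cmod (F g) \<le> B" using assms by (auto simp: bounded_iff)
  then show ?thesis by (intro boundedI[of _ "cmod c * B"]) (auto simp: norm_mult mult_left_mono)
qed

lemma abelian_group_bounded_function_space:
  "abelian_group (bounded_function_space :: ('u + ('a \<Rightarrow> complex)) cnormed)"
proof (rule abelian_groupI)
  fix x :: "'u + ('a \<Rightarrow> complex)" assume "x \<in> carrier bounded_function_space"
  then obtain F where F: "x = Inr F" "bounded (range F)" by auto
  then show "\<exists>y\<in>carrier bounded_function_space. y \<oplus>\<^bsub>bounded_function_space\<^esub> x = \<zero>\<^bsub>bounded_function_space\<^esub>"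
    using bounded_cmult[OF F(2), of "-1"] by (intro bexI[of _ "Inr (\<lambda>g. -1 * F g)"]) auto
qed (auto simp: add_ac intro!: imageI bounded_plus_comp)

lemma module_bounded_function_space:
  "module complex_field (bounded_function_space :: ('u + ('a \<Rightarrow> complex)) cnormed)"
  by (rule moduleI[OF cring_complex_field abelian_group_bounded_function_space])
    (auto simp: algebra_simps intro!: imageI bounded_cmult)

lemma bounded_function_space_minus:
  assumes "bounded (range F)" "bounded (range G)"
  shows "Inr F \<ominus>\<^bsub>bounded_function_space\<^esub> Inr G = (Inr (\<lambda>g. F g - G g) :: 'u + ('a \<Rightarrow> complex))"
proof -
  interpret abelian_group "bounded_function_space :: ('u + ('a \<Rightarrow> complex)) cnormed"
    by (rule abelian_group_bounded_function_space)
  have "\<ominus>\<^bsub>bounded_function_space\<^esub> Inr G = (Inr (\<lambda>g. - G g) :: 'u + ('a \<Rightarrow> complex))"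
    by (rule minus_equality) (use assms bounded_cmult[OF assms(2), of "-1"] in auto)
  then show ?thesis by (simp add: a_minus_def)
qed

lemma complex_banach_bounded_function_space:
  "complex_banach (bounded_function_space :: ('u + ('a \<Rightarrow> complex)) cnormed)"
  (is "complex_banach ?Y")
proof -
  interpret module complex_field ?Y by (rule module_bounded_function_space)
  have upper: "cmod (F g) \<le> nrm ?Y (Inr F)" if "bounded (range F)" for F g
    by (rule bounded_function_space_norm_upper[OF that])
  have least: "nrm ?Y (Inr F) \<le> B" if "\<And>g. cmod (F g) \<le> B" for F B
    by (rule bounded_function_space_norm_least[OF that])
  show ?thesis
  proof
    fix x :: "'u + ('a \<Rightarrow> complex)" assume "x \<in> carrier ?Y"
    then obtain F where F: "x = Inr F" "bounded (range F)" by auto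
    show "0 \<le> nrm ?Y x" using upper[OF F(2), of undefined] F(1) by (meson norm_ge_zero order.trans)
    show "nrm ?Y x = 0 \<longleftrightarrow> x = \<zero>\<^bsub>?Y\<^esub>"
    proof
      assume "nrm ?Y x = 0"
      then have "F g = 0" for g using upper[OF F(2), of g] F(1) by simp
      then show "x = \<zero>\<^bsub>?Y\<^esub>" using F(1) by auto
    next
      assume "x = \<zero>\<^bsub>?Y\<^esub>"
      then show "nrm ?Y x = 0" by (simp add: bounded_function_space_def)
    qed
    have le: "nrm ?Y (c \<odot>\<^bsub>?Y\<^esub> Inr G) \<le> cmod c * nrm ?Y (Inr G)" if "bounded (range G)" for c G
      using upper[OF that] by (simp add: least norm_mult mult_left_mono)
    fix c
    show "nrm ?Y (c \<odot>\<^bsub>?Y\<^esub> x) = cmod c * nrm ?Y x"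
    proof (cases "c = 0")
      case True
      then show ?thesis by (simp add: bounded_function_space_def)
    next
      case False
      have "nrm ?Y (inverse c \<odot>\<^bsub>?Y\<^esub> Inr (\<lambda>g. c * F g)) \<le> cmod (inverse c) * nrm ?Y (Inr (\<lambda>g. c * F g))"
        by (rule le[OF bounded_cmult[OF F(2)]])
      then have "nrm ?Y x \<le> nrm ?Y (c \<odot>\<^bsub>?Y\<^esub> x) / cmod c"
        using False F(1) by (simp add: norm_inverse divide_inverse mult.commute flip: mult.assoc)
      then have "cmod c * nrm ?Y x \<le> nrm ?Y (c \<odot>\<^bsub>?Y\<^esub> x)"
        using False by (simp add: pos_le_divide_eq mult.commute del: bounded_function_space_simps)
      then show ?thesis using le[OF F(2), of c] F(1) by simp
    qed
    fix y :: "'u + ('a \<Rightarrow> complex)" assume "y \<in> carrier ?Y"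
    then obtain G where G: "y = Inr G" "bounded (range G)" by auto
    show "nrm ?Y (x \<oplus>\<^bsub>?Y\<^esub> y) \<le> nrm ?Y x + nrm ?Y y"
      using F G upper[OF F(2)] upper[OF G(2)] by (simp add: least norm_triangle_mono)
  next
    fix u :: "nat \<Rightarrow> 'u + ('a \<Rightarrow> complex)"
    assume u: "range u \<subseteq> carrier ?Y"
      and Cauchy: "\<forall>\<epsilon>>0. \<exists>N. \<forall>m\<ge>N. \<forall>n\<ge>N. nrm ?Y (u m \<ominus>\<^bsub>?Y\<^esub> u n) < \<epsilon>"
    have "\<forall>n. \<exists>F. u n = Inr F \<and> bounded (range F)" using u by (auto simp: image_subset_iff)
    then obtain F where F: "\<And>n. u n = Inr (F n)" "\<And>n. bounded (range (F n))" by metis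
    have diff: "bounded (range (\<lambda>g. F m g - H g))" if "bounded (range H)" for m H
      using bounded_minus_comp[OF F(2) that] .
    have "uniformly_Cauchy_on UNIV F"
      unfolding uniformly_Cauchy_on_def
    proof (intro allI impI)
      fix e :: real assume "e > 0"
      then obtain N where N: "\<forall>m\<ge>N. \<forall>n\<ge>N. nrm ?Y (u m \<ominus>\<^bsub>?Y\<^esub> u n) < e" using Cauchy by blast
      have "dist (F m g) (F n g) < e" if "m \<ge> N" "n \<ge> N" for m n g
        using N that upper[OF diff[where m = m, OF F(2)[of n]], where g = g]
        by (auto simp: F bounded_function_space_minus dist_norm intro: le_less_trans)
      then show "\<exists>M. \<forall>x\<in>UNIV. \<forall>m\<ge>M. \<forall>n\<ge>M. dist (F m x) (F n x) < e" by blast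
    qed
    then obtain G where G: "uniform_limit UNIV F G sequentially"
      unfolding uniformly_convergent_eq_Cauchy[symmetric] uniformly_convergent_on_def by blast
    have "\<forall>\<^sub>F n in sequentially. \<forall>g\<in>UNIV. dist (F n g) (G g) < 1"
      by (rule uniform_limitD[OF G]) simp
    then obtain N where N: "\<And>g. dist (F N g) (G g) < 1" by (auto simp: eventually_sequentially)
    have bG: "bounded (range G)"
    proof -
      obtain B where B: "\<And>g. cmod (F N g) \<le> B" using F(2)[of N] by (auto simp: bounded_iff)
      have "cmod (G g) \<le> B + 1" for g
        using N[of g] B[of g] norm_triangle_ineq2[of "G g" "F N g"]
        by (simp add: dist_norm norm_minus_commute)
      then show ?thesis by (intro boundedI[of _ "B + 1"]) auto
    qed
    have "(\<lambda>n. nrm ?Y (u n \<ominus>\<^bsub>?Y\<^esub> Inr G)) \<longlonglongrightarrow> 0"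
    proof (rule tendstoI)
      fix e :: real assume "e > 0"
      then have "\<forall>\<^sub>F n in sequentially. \<forall>g\<in>UNIV. dist (F n g) (G g) < e / 2"
        by (intro uniform_limitD[OF G]) simp
      then show "\<forall>\<^sub>F n in sequentially. dist (nrm ?Y (u n \<ominus>\<^bsub>?Y\<^esub> Inr G)) 0 < e"
      proof eventually_elim
        case (elim n)
        have "nrm ?Y (Inr (\<lambda>g. F n g - G g)) \<le> e / 2"
          using elim by (intro least) (auto simp: dist_norm less_imp_le)
        moreover have "0 \<le> nrm ?Y (Inr (\<lambda>g. F n g - G g))"
          using upper[OF diff[where m = n, OF bG], where g = undefined] by (meson norm_ge_zero order.trans)
        ultimately show ?case
          using \<open>e > 0\<close> by (simp add: F bounded_function_space_minus bG dist_real_def)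
      qed
    qed
    then show "\<exists>l\<in>carrier ?Y. (\<lambda>n. nrm ?Y (u n \<ominus>\<^bsub>?Y\<^esub> l)) \<longlonglongrightarrow> 0"
      using bG by (intro bexI[of _ "Inr G"]) auto
  qed
qed

text \<open>
  The type of the vectors forces bounded functions to live on \<open>complex \<Rightarrow> complex\<close>.  A surjection of this
  index type onto the real line lets such functions represent all bounded functions on the line; the
  point \<open>t\<close> is hit by the constant function with value \<open>t\<close>.
\<close>

definition axis_point :: "(complex \<Rightarrow> complex) \<Rightarrow> real" where
  "axis_point g = Re (g 0)"

definition axis_embedding :: "(complex \<Rightarrow> complex) \<Rightarrow> 'u + ((complex \<Rightarrow> complex) \<Rightarrow> complex)" where
  "axis_embedding D = Inr (\<lambda>g. D (\<i> * of_real (axis_point g)))"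

lemma axis_point_const [simp]: "axis_point (\<lambda>_. of_real t) = t"
  by (simp add: axis_point_def)

lemma bounded_dirichlet_polynomial:
  "bounded (range (\<lambda>g. dirichlet_polynomial \<omega> J a (\<i> * of_real (axis_point g))))"
  using dirichlet_space_norm_bounds(1) by (intro boundedI) blast

lemma isometric_axis_embedding:
  "isometric_embedding (dirichlet_space \<omega> J) bounded_function_space axis_embedding"
  unfolding isometric_embedding_def linear_between_def
proof (intro conjI ballI allI)
  let ?X = "dirichlet_space \<omega> J" and ?dp = "dirichlet_polynomial \<omega> J"
  show "axis_embedding \<in> carrier ?X \<rightarrow> carrier bounded_function_space"
    by (auto simp: axis_embedding_def bounded_dirichlet_polynomial)
  fix x assume "x \<in> carrier ?X"
  then obtain a where a: "x = ?dp a" by auto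
  show "nrm bounded_function_space (axis_embedding x) = nrm ?X x"
  proof (rule antisym)
    show "nrm bounded_function_space (axis_embedding x) \<le> nrm ?X x"
      unfolding a axis_embedding_def
      by (intro bounded_function_space_norm_least dirichlet_space_norm_bounds(1))
    show "nrm ?X x \<le> nrm bounded_function_space (axis_embedding x)"
      unfolding a axis_embedding_def
    proof (rule dirichlet_space_norm_bounds(2))
      fix t show "cmod (?dp a (\<i> * of_real t))
          \<le> nrm bounded_function_space (Inr (\<lambda>g. ?dp a (\<i> * of_real (axis_point g))))"
        using bounded_function_space_norm_upper[OF bounded_dirichlet_polynomial,
            of \<omega> J a "\<lambda>_. of_real t"] by simp
    qed
  qed
qed (auto simp: axis_embedding_def)

text \<open>
  A projection on the bounded functions of the index type induces, by lifting functions on the line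
  along the surjection and evaluating at the constant functions, an operator on the bounded functions
  on the line to which averaging applies.
\<close>

lemma projection_norm_ge:
  assumes J: "finite J" "inj_on \<omega> J"
    and L: "ap_mean (\<lambda>t. of_real (cmod (dirichlet_kernel \<omega> J t))) (of_real L)"
    and P: "P \<in> projections (axis_embedding ` carrier (dirichlet_space \<omega> J))
              (bounded_function_space :: ('u + ((complex \<Rightarrow> complex) \<Rightarrow> complex)) cnormed)"
      (is "P \<in> projections ?S ?Y")
  shows "ennreal L \<le> op_norm ?Y ?Y P"
proof -
  let ?dp = "dirichlet_polynomial \<omega> J"
  define lift :: "(real \<Rightarrow> complex) \<Rightarrow> 'u + ((complex \<Rightarrow> complex) \<Rightarrow> complex)"
    where "lift f = Inr (\<lambda>g. f (axis_point g))" for f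
  define T where "T f s = projr (P (lift f)) (\<lambda>_. of_real s)" for f s
  have P_lin: "linear_between ?Y (?Y\<lparr>carrier := ?S\<rparr>) P"
    using P unfolding projections_def by blast
  have P_in: "P x \<in> ?S" if "x \<in> carrier ?Y" for x
    using P_lin that unfolding linear_between_def by (auto simp del: bounded_function_space_simps)
  have P_add: "P (x \<oplus>\<^bsub>?Y\<^esub> y) = P x \<oplus>\<^bsub>?Y\<^esub> P y" if "x \<in> carrier ?Y" "y \<in> carrier ?Y" for x y
    using P_lin that unfolding linear_between_def by (simp del: bounded_function_space_simps)
  have P_smult: "P (c \<odot>\<^bsub>?Y\<^esub> x) = c \<odot>\<^bsub>?Y\<^esub> P x" if "x \<in> carrier ?Y" for c x
    using P_lin that unfolding linear_between_def by (simp del: bounded_function_space_simps)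
  have P_fix: "P x = x" if "x \<in> ?S" for x
    using P that unfolding projections_def by blast
  have lift_in: "lift f \<in> carrier ?Y" if "bounded (range f)" for f
    using that by (auto simp: lift_def intro!: imageI elim: bounded_subset)
  obtain C where C: "op_norm ?Y ?Y P = ennreal C" "0 \<le> C"
    using P unfolding projections_def by (cases "op_norm ?Y ?Y P" rule: ennreal_cases) auto
  have "L \<le> C"
  proof (rule averaging_lower_bound[OF J _ _ _ _ _ L])
    fix f g :: "real \<Rightarrow> complex" assume "bounded (range f)" "bounded (range g)"
    moreover have "lift (\<lambda>t. f t + g t) = lift f \<oplus>\<^bsub>?Y\<^esub> lift g" by (simp add: lift_def)
    ultimately have "P (lift (\<lambda>t. f t + g t)) = P (lift f) \<oplus>\<^bsub>?Y\<^esub> P (lift g)"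
      by (simp only: P_add[OF lift_in lift_in])
    then show "T (\<lambda>t. f t + g t) = (\<lambda>t. T f t + T g t)" by (simp add: fun_eq_iff T_def)
  next
    fix c and f :: "real \<Rightarrow> complex" assume "bounded (range f)"
    moreover have "lift (\<lambda>t. c * f t) = c \<odot>\<^bsub>?Y\<^esub> lift f" by (simp add: lift_def)
    ultimately have "P (lift (\<lambda>t. c * f t)) = c \<odot>\<^bsub>?Y\<^esub> P (lift f)"
      by (simp only: P_smult[OF lift_in])
    then show "T (\<lambda>t. c * f t) = (\<lambda>t. c * T f t)" by (simp add: fun_eq_iff T_def)
  next
    fix f :: "real \<Rightarrow> complex" assume "bounded (range f)"
    from P_in[OF lift_in[OF this]] obtain a where "P (lift f) = axis_embedding (?dp a)" by auto
    then have "T f = (\<lambda>t. \<Sum>n\<in>J. a n * cis (- \<omega> n * t))"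
      by (simp add: fun_eq_iff T_def axis_embedding_def dirichlet_polynomial_imaginary_axis)
    then show "\<exists>a. T f = (\<lambda>t. \<Sum>n\<in>J. a n * cis (- \<omega> n * t))" by blast
  next
    fix n assume n: "n \<in> J"
    have "?dp (\<lambda>k. if k = n then 1 else 0) (\<i> * of_real t) = cis (- \<omega> n * t)" for t
      unfolding dirichlet_polynomial_imaginary_axis using n J(1)
      by (simp add: if_distrib[of "\<lambda>c. c * _"] cong: if_cong)
    then have "lift (\<lambda>t. cis (- \<omega> n * t)) = axis_embedding (?dp (\<lambda>k. if k = n then 1 else 0))"
      by (simp only: lift_def axis_embedding_def)
    then have "lift (\<lambda>t. cis (- \<omega> n * t)) \<in> ?S" by auto
    from P_fix[OF this] show "T (\<lambda>t. cis (- \<omega> n * t)) = (\<lambda>t. cis (- \<omega> n * t))"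
      by (simp add: fun_eq_iff T_def) (simp add: lift_def)
  next
    fix f :: "real \<Rightarrow> complex" and t assume f: "\<And>s. cmod (f s) \<le> 1"
    have bf: "bounded (range f)" using f by (intro boundedI) auto
    have "nrm ?Y (lift f) \<le> 1" unfolding lift_def using f by (intro bounded_function_space_norm_least)
    then have "ennreal (nrm ?Y (P (lift f))) \<le> op_norm ?Y ?Y P"
      unfolding op_norm_def using lift_in[OF bf] by (intro SUP_upper) auto
    then have 1: "nrm ?Y (P (lift f)) \<le> C" using C by simp
    obtain a where a: "P (lift f) = axis_embedding (?dp a)" using P_in[OF lift_in[OF bf]] by auto
    have "cmod (T f t) \<le> nrm ?Y (P (lift f))"
      unfolding T_def a axis_embedding_def sum.sel
      by (rule bounded_function_space_norm_upper[OF bounded_dirichlet_polynomial])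
    then show "cmod (T f t) \<le> C" using 1 by linarith
  qed
  then show ?thesis unfolding C(1) by (rule ennreal_leI)
qed

section \<open>The projection constant\<close>

theorem theorem3p1:
  fixes \<omega> :: "nat \<Rightarrow> real" and J :: "nat set"
  assumes "frequency \<omega>" and "finite J"
  shows "\<exists>L::real.
    ((\<lambda>T::real. 1 / (2 * T) *
        integral {-T..T} (\<lambda>t. cmod (\<Sum>n\<in>J. exp (- \<i> * of_real (\<omega> n) * of_real t))))
      \<longlongrightarrow> L) at_top \<and>
    projection_constant TYPE('u) (dirichlet_space \<omega> J) = ennreal L"
proof -
  have inj: "inj_on \<omega> J"
    using assms(1) strict_mono_imp_inj_on[of \<omega>] by (auto simp: frequency_def intro: inj_on_subset)
  have kernel: "dirichlet_kernel \<omega> J t = (\<Sum>n\<in>J. exp (- \<i> * of_real (\<omega> n) * of_real t))" for t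
    unfolding dirichlet_kernel_def cis_conv_exp by (simp add: mult.assoc)
  obtain L where L: "ap_mean (\<lambda>t. of_real (cmod (dirichlet_kernel \<omega> J t))) (of_real L)"
    and lim: "((\<lambda>T. 1 / (2 * T) * integral {-T..T} (\<lambda>t. cmod (dirichlet_kernel \<omega> J t))) \<longlongrightarrow> L) at_top"
    using dirichlet_kernel_mean[OF assms(2), of \<omega>] by blast
  let ?X = "dirichlet_space \<omega> J"
  let ?Y = "bounded_function_space :: ('u + ((complex \<Rightarrow> complex) \<Rightarrow> complex)) cnormed"
  let ?S = "axis_embedding ` carrier ?X"
  have embedding: "dirichlet_embedding Y \<omega> J I"
    if "complex_banach Y" "isometric_embedding ?X Y I"
    for Y :: "('u + ((complex \<Rightarrow> complex) \<Rightarrow> complex)) cnormed" and I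
    using that inj assms(2) by (simp add: dirichlet_embedding_def dirichlet_embedding_axioms_def)
  have "projection_constant TYPE('u) ?X = ennreal L"
  proof (rule antisym)
    show "projection_constant TYPE('u) ?X \<le> ennreal L"
      unfolding projection_constant_def
    proof (rule Sup_least, clarify)
      fix Y :: "('u + ((complex \<Rightarrow> complex) \<Rightarrow> complex)) cnormed" and I
      assume "complex_banach Y" "isometric_embedding ?X Y I"
      then show "relative_projection_constant (I ` carrier ?X) Y \<le> ennreal L"
        by (rule dirichlet_embedding.relative_projection_constant_le[OF embedding L])
    qed
    have "ennreal L \<le> relative_projection_constant ?S ?Y"
      unfolding relative_projection_constant_def
      by (rule INF_greatest) (rule projection_norm_ge[OF assms(2) inj L])
    also have "\<dots> \<le> projection_constant TYPE('u) ?X"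
      unfolding projection_constant_def
      using dirichlet_embedding.complemented[OF embedding]
        complex_banach_bounded_function_space isometric_axis_embedding
      by (intro Sup_upper CollectI exI[of _ ?Y] exI[of _ axis_embedding] conjI refl) auto
    finally show "ennreal L \<le> projection_constant TYPE('u) ?X" .
  qed
  with lim show ?thesis unfolding kernel by blast
qed

end
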